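(* Let $\beta,B_0,\bar D,\kappa>0$. Consider joint distributions of $(\boldsymbol X,D)$ such that: $D$ is supported in $[0,\bar D]$; the support of $\boldsymbol X$ is $\mathcal X=[0,1]^p$ and the law of $\boldsymbol X$ is absolutely continuous with respect to Lebesgue measure; the conditional $\rho$-th quantile function $f_\rho$ belongs to $\mathcal{H}^\beta([0,1]^p,B_0)$; and (i) the density function of the conditional distribution $D\mid\boldsymbol X$ is Lipschitz continuous and uniformly lower bounded by $\kappa$ (on its support); (ii) the marginal density function of $\boldsymbol X$ has a finite upper bound over $\mathcal X$. Then $$\inf_{\hat{f}_n}\ \sup_{f_\rho\in \mathcal{H}^{\beta}([0,1]^p,B_0)} \mathbb{E} \Big[ \mathcal{R}^\rho(\hat{f}_n)-\mathcal{R}^\rho(f_\rho)\Big] \ge c\, n^{-\frac{2\beta}{p+2\beta}},$$ where $c$ is some positive constant (not depending on $n$), the infimum is taken over all possible estimators $\hat f_n$ based on $n$ i.i.d. random samples $\boldsymbol S_n=\{(\boldsymbol x_i,d_i)\}_{i=1}^n$ from the joint distribution of $(\boldsymbol X,D)$, and the supremum is over such distributions with the $\rho$-th quantile of the conditional distribution $D\mid\boldsymbol X$ being $f_\rho(\boldsymbol X)$, $f_\rho\in\mathcal{H}^{\beta}([0,1]^p,B_0)$.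
   Context: Newsvendor setting. Let $b,h>0$ be the unit underage and overage costs, $\rho:=b/(b+h)$, and $a^+:=\max\{a,0\}$. $D$ is a real random variable (demand) and $\boldsymbol X$ an $\mathbb{R}^p$-valued random feature vector. $F(\cdot\mid \boldsymbol x)$ is the conditional CDF of $D$ given $\boldsymbol X=\boldsymbol x$ and $f_\rho(\boldsymbol x):=\inf\{q\ge 0: F(q\mid\boldsymbol X=\boldsymbol x)\ge\rho\}$. For a measurable $f:\mathbb{R}^p\to\mathbb{R}$ the risk is $\mathcal{R}^\rho(f):=\mathbb{E}_{(\boldsymbol X,D)}[b(D-f(\boldsymbol X))^++h(f(\boldsymbol X)-D)^+]$. For an estimator $\hat f_n$ (a sample-dependent function), $\mathcal{R}^\rho(\hat f_n)$ is the expectation over a fresh $(\boldsymbol X,D)$ with $\hat f_n$ held fixed, and the outer $\mathbb{E}$ is over the samples $\boldsymbol S_n$. Hölder class. For $\beta,B_0>0$ and $\mathcal X\subset\mathbb{R}^p$, with $s=\lfloor\beta\rfloor$ (largest integer strictly smaller than $\beta$) and $r=\beta-s\in(0,1]$, $$\mathcal{H}^\beta(\mathcal{X},B_0):=\Big\{f:\mathcal{X}\to\mathbb{R},\ \max_{\|\boldsymbol\alpha\|_1\le s}\|\partial^{\boldsymbol\alpha}f\|_\infty\le B_0,\ \max_{\|\boldsymbol\alpha\|_1=s}\sup_{x\ne y}\frac{|\partial^{\boldsymbol\alpha}f(x)-\partial^{\boldsymbol\alpha}f(y)|}{\|x-y\|_2^r}\le B_0\Big\},$$ where $\boldsymbol\alpha=(\alpha_1,\dots,\alpha_p)$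 ranges over vectors of non-negative integers and $\|\boldsymbol\alpha\|_1=\sum_i\alpha_i$. *)

theory Defs
  imports "HOL-Probability.Probability"
begin

definition msupport :: "'a::topological_space measure \<Rightarrow> 'a set" where
  "msupport M = {x. \<forall>U. open U \<longrightarrow> x \<in> U \<longrightarrow> emeasure M U > 0}"

definition unit_cube :: "(real^'p::finite) set" where
  "unit_cube = {x. \<forall>i. 0 \<le> x $ i \<and> x $ i \<le> 1}"


section \<open>Hoelder classes\<close>

text \<open>The largest integer strictly smaller than \<open>\<beta>\<close>; in particular it is \<open>\<beta> - 1\<close> when \<open>\<beta>\<close>
  is a positive integer.\<close>

definition smoothness_order :: "real \<Rightarrow> nat" where
  "smoothness_order \<beta> = nat (\<lceil>\<beta>\<rceil> - 1)"

definition mi_order :: "('p::finite \<Rightarrow> nat) \<Rightarrow> nat" where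
  "mi_order \<alpha> = (\<Sum>i\<in>UNIV. \<alpha> i)"

text \<open>\<open>G \<alpha>\<close> is the partial derivative of \<open>f\<close> of multi-index \<open>\<alpha>\<close> on \<open>X\<close>, for all \<open>\<alpha>\<close> of order at
  most \<open>s\<close>. Partial derivatives are taken within \<open>X\<close>, hence are one-sided at the boundary points
  of the unit cube, where they determine \<open>G\<close> on \<open>X\<close> uniquely up to order \<open>s\<close>.\<close>

definition partial_derivs ::
  "(real^'p::finite) set \<Rightarrow> nat \<Rightarrow> (real^'p \<Rightarrow> real) \<Rightarrow> (('p \<Rightarrow> nat) \<Rightarrow> real^'p \<Rightarrow> real) \<Rightarrow> bool" where
  "partial_derivs X s f G \<longleftrightarrow>
     (\<forall>x\<in>X. G (\<lambda>_. 0) x = f x) \<and>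
     (\<forall>\<alpha> i. mi_order \<alpha> < s \<longrightarrow> (\<forall>x\<in>X.
        ((\<lambda>t. G \<alpha> (x + t *\<^sub>R axis i 1)) has_real_derivative G (\<alpha>(i := Suc (\<alpha> i))) x)
          (at 0 within {t. x + t *\<^sub>R axis i 1 \<in> X})))"

text \<open>Membership depends only on the restriction of \<open>f\<close> to \<open>X\<close>.\<close>

definition holder_class :: "real \<Rightarrow> (real^'p::finite) set \<Rightarrow> real \<Rightarrow> (real^'p \<Rightarrow> real) set" where
  "holder_class \<beta> X B\<^sub>0 = {f. \<exists>G. partial_derivs X (smoothness_order \<beta>) f G \<and>
     (\<forall>\<alpha>. mi_order \<alpha> \<le> smoothness_order \<beta> \<longrightarrow> (\<forall>x\<in>X. \<bar>G \<alpha> x\<bar> \<le> B\<^sub>0)) \<and>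
     (\<forall>\<alpha>. mi_order \<alpha> = smoothness_order \<beta> \<longrightarrow> (\<forall>x\<in>X. \<forall>y\<in>X. x \<noteq> y \<longrightarrow>
        \<bar>G \<alpha> x - G \<alpha> y\<bar> / norm (x - y) powr (\<beta> - real (smoothness_order \<beta>)) \<le> B\<^sub>0))}"


section \<open>Newsvendor model\<close>

text \<open>Joint laws of \<open>(X, D)\<close> are Borel probability measures \<open>P\<close> on the product space; a kernel \<open>K\<close>
  is a regular conditional distribution of \<open>D\<close> given \<open>X\<close>.\<close>

definition cond_distribution ::
  "('a::topological_space \<times> real) measure \<Rightarrow> ('a \<Rightarrow> real measure) \<Rightarrow> bool" where
  "cond_distribution P K \<longleftrightarrow>
     K \<in> borel \<rightarrow>\<^sub>M prob_algebra borel \<and>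
     (\<forall>A\<in>sets borel. \<forall>B\<in>sets borel.
        emeasure P (A \<times> B) = (\<integral>\<^sup>+x. emeasure (K x) B * indicator A x \<partial>distr P borel fst))"

definition cond_quantile :: "('a \<Rightarrow> real measure) \<Rightarrow> real \<Rightarrow> 'a \<Rightarrow> real" where
  "cond_quantile K \<rho> x = Inf {q. q \<ge> 0 \<and> cdf (K x) q \<ge> \<rho>}"

text \<open>The risk takes values in \<open>[0, \<infinity>]\<close>: predictors with non-integrable loss have infinite
  risk.\<close>

definition risk :: "real \<Rightarrow> real \<Rightarrow> ('a \<times> real) measure \<Rightarrow> ('a \<Rightarrow> real) \<Rightarrow> ennreal" where
  "risk b h P f = (\<integral>\<^sup>+(x, d). ennreal (b * max (d - f x) 0 + h * max (f x - d) 0) \<partial>P)"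

text \<open>The Lipschitz constant \<open>L\<close> and the bound \<open>M\<close> may depend on the distribution, whereas the
  lower bound \<open>\<kappa>\<close> is common to the whole class. A density bounded below by a positive constant
  on its bounded support cannot be continuous on the whole line, so Lipschitz continuity is
  required on the support only.\<close>

definition newsvendor_class ::
  "real \<Rightarrow> real \<Rightarrow> real \<Rightarrow> real \<Rightarrow> real \<Rightarrow>
    (((real^'p::finite) \<times> real) measure \<times> (real^'p \<Rightarrow> real measure)) set" where
  "newsvendor_class \<rho> \<beta> B\<^sub>0 Dbar \<kappa> = {(P, K).
     prob_space P \<and> sets P = sets borel \<and> cond_distribution P K \<and>
     msupport (distr P borel snd) \<subseteq> {0..Dbar} \<and>
     msupport (distr P borel fst) = unit_cube \<and>
     absolutely_continuous lborel (distr P borel fst) \<and>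
     cond_quantile K \<rho> \<in> holder_class \<beta> unit_cube B\<^sub>0 \<and>
     (\<exists>g L. \<forall>x\<in>unit_cube.
        distributed (K x) lborel (\<lambda>d. d) (\<lambda>d. ennreal (g x d)) \<and>
        L-lipschitz_on (msupport (K x)) (g x) \<and>
        (\<forall>d\<in>msupport (K x). \<kappa> \<le> g x d)) \<and>
     (\<exists>u M. distributed P lborel fst (\<lambda>x. ennreal (u x)) \<and>
        (\<forall>x\<in>unit_cube. u x \<le> M))}"

text \<open>A sample of size \<open>n\<close> is a function on \<open>{..<n}\<close>. An estimator maps a sample to a predictor,
  jointly measurably in the sample and the new feature vector.\<close>

definition estimators :: "nat \<Rightarrow> ((nat \<Rightarrow> (real^'p::finite) \<times> real) \<Rightarrow> real^'p \<Rightarrow> real) set" where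
  "estimators n = {fhat. (\<lambda>(S, x). fhat S x)
     \<in> borel_measurable ((\<Pi>\<^sub>M i\<in>{..<n}. (borel :: ((real^'p) \<times> real) measure)) \<Otimes>\<^sub>M borel)}"

text \<open>Subtraction on \<open>ennreal\<close> is truncated at \<open>0\<close>, which has no effect on members \<open>(P, K)\<close> of the
  class: there the conditional quantile has finite risk, minimal among all measurable
  predictors.\<close>

definition expected_excess_risk ::
  "real \<Rightarrow> real \<Rightarrow> nat \<Rightarrow> ((real^'p::finite) \<times> real) measure \<Rightarrow> (real^'p \<Rightarrow> real) \<Rightarrow>
    ((nat \<Rightarrow> (real^'p) \<times> real) \<Rightarrow> real^'p \<Rightarrow> real) \<Rightarrow> ennreal" where
  "expected_excess_risk b h n P f\<^sub>\<rho> fhat =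
     (\<integral>\<^sup>+S. (risk b h P (fhat S) - risk b h P f\<^sub>\<rho>) \<partial>(\<Pi>\<^sub>M i\<in>{..<n}. P))"

end

theory Submission
  imports Defs
begin

text \<open>Assouad's method. The features are uniform on the cube and the demand has, given \<open>X = x\<close>, a
  linearly tilted uniform density on \<open>[0, w]\<close>; the tilt can be chosen so as to put the
  \<open>\<rho>\<close>-quantile at any prescribed value close to \<open>\<rho> w\<close>. The quantile functions are \<open>\<rho> w\<close> plus a
  sum of bumps of height about \<open>m powr - \<beta>\<close> over an arbitrary set of cells of a grid of mesh
  \<open>1 / m\<close>, which is bounded in the Hoelder class uniformly in \<open>m\<close>. Switching one bump on or off
  changes the law of one observation by at most a multiple of \<open>m powr (- 2 * \<beta> - p)\<close> in
  chi-square distance, so with \<open>m powr (2 * \<beta> + p)\<close> of order \<open>n\<close> no estimator detects the state of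
  a fixed bump from \<open>n\<close> observations. Since the conditional density is bounded below, the excess risk grows
  quadratically in the error of the predictor; averaging over all sets of cells gives the rate.\<close>

section \<open>A smooth bump\<close>

text \<open>The obstacle is that a conditional density must stay above \<kappa> up to the edges of
  its support. Moving a quantile by shifting the law would move a jump of the density: neither law
  would dominate the other, and the chi-square distance would be infinite. A tilt keeps the support
  \<open>[0, w]\<close> fixed and the density affine and at least \<open>1 / (2 * w)\<close>, and
  its chi-square cost is quadratic in the displacement. Since supports may be shorter than
  \<open>[0, Dbar]\<close>, a small w meets any \<kappa>, even when \<open>\<kappa> * Dbar\<close>
  exceeds one. The tilt depends nonlinearly on the quantile, but bumps sit on disjoint cells, so
  switching one bump multiplies the joint density by the same factor whatever the other bumps do.
  One testing bound thus serves all backgrounds. The middle parts of the cells fill a fraction of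
  the cube that does not depend on the mesh, so local errors of squared size
  \<open>m powr (- 2 * \<beta>)\<close> add up to the same order. Risks are extended nonnegative
  reals. Inequalities between them are therefore proved in additive form, and subtraction enters
  only once the risk of the quantile is known to be finite.\<close>

lemma power_dvd_pderiv:
  fixes q P :: "real poly"
  assumes "q ^ Suc n dvd P"
  shows "q ^ n dvd pderiv P"
proof -
  obtain r where r: "P = q ^ Suc n * r" using assms by (auto elim: dvdE)
  have "pderiv P = q ^ n * (q * pderiv r + r * smult (of_nat (Suc n)) (pderiv q))"
    unfolding r pderiv_mult pderiv_power_Suc by (simp add: algebra_simps)
  then show ?thesis by simp
qed

text \<open>Each differentiation costs at most one factor \<open>q\<close>.\<close>

lemma power_dvd_iterated_pderiv:
  fixes q P :: "real poly"
  assumes "q ^ (n + a) dvd P"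
  shows "q ^ n dvd (pderiv ^^ a) P"
  using assms
proof (induction a arbitrary: n)
  case (Suc a)
  from Suc.IH[of "Suc n"] Suc.prems have "q ^ Suc n dvd (pderiv ^^ a) P" by simp
  from power_dvd_pderiv[OF this] show ?case by simp
qed simp

text \<open>At 0 and 1 the polynomial and the zero function agree in value and in slope, so the
  pieces glue to a differentiable function.\<close>

lemma has_derivative_poly_cut:
  fixes P :: "real poly"
  assumes "poly P 0 = 0" "poly P 1 = 0" "poly (pderiv P) 0 = 0" "poly (pderiv P) 1 = 0"
  shows "((\<lambda>t. if t \<in> {0..1} then poly P t else 0) has_real_derivative
           (if t \<in> {0..1} then poly (pderiv P) t else 0)) (at t)"
proof -
  have cl: "closure ({..0} \<union> {1..}) = {..0} \<union> {1::real..}"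
    by (intro closure_closed closed_Un) auto
  have I: "{0..1} \<inter> ({..0} \<union> {1..}) = {0, 1::real}" by auto
  have P: "(poly P has_vector_derivative poly (pderiv P) t) (at t within S)" for t S
    using poly_DERIV[of P t, THEN has_field_derivative_at_within]
    by (simp add: has_real_derivative_iff_has_vector_derivative)
  from P[of 0] P[of 1] assms
  have P01: "(poly P has_vector_derivative 0) (at 0 within S)"
    "(poly P has_vector_derivative 0) (at 1 within S)" for S
    by auto
  have "((\<lambda>t. if t \<in> {0..1} then poly P t else 0) has_vector_derivative
           (if t \<in> {0..1} then poly (pderiv P) t else 0)) (at t within UNIV)"
    by (rule has_vector_derivative_If_within_closures[where T = "{..0} \<union> {1..}"])
      (use assms P P01 in \<open>auto simp: cl I\<close>)
  then show ?thesis by (simp add: has_real_derivative_iff_has_vector_derivative)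
qed

text \<open>\<open>\<phi> a\<close> is the a-th derivative of
  \<open>(t * (1 - t)) ^ (s + 2)\<close>, cut off outside the unit interval and rescaled. Finite
  smoothness is enough for a class of order s, and a polynomial gives all bounds by
  compactness.\<close>

lemma smooth_bump_1d:
  fixes s :: nat
  obtains \<phi> :: "nat \<Rightarrow> real \<Rightarrow> real" and \<eta> :: real
  where "\<And>a t. a \<le> s \<Longrightarrow> (\<phi> a has_real_derivative \<phi> (Suc a) t) (at t)"
    and "\<And>a t. a \<le> Suc s \<Longrightarrow> t \<notin> {0<..<1} \<Longrightarrow> \<phi> a t = 0"
    and "\<And>a t. a \<le> Suc s \<Longrightarrow> \<bar>\<phi> a t\<bar> \<le> 1"
    and "\<And>t. 0 \<le> \<phi> 0 t" and "0 < \<eta>" and "\<And>t. t \<in> {1/4..3/4} \<Longrightarrow> \<eta> \<le> \<phi> 0 t"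
proof -
  define q :: "real poly" where "q = [:0, 1, -1:]"
  define P where "P a = (pderiv ^^ a) (q ^ (s + 2))" for a
  have P0: "poly (P a) t = 0" if "a \<le> Suc s" "t \<in> {0, 1}" for a t
  proof -
    \<comment> \<open>The exponent s + 2 leaves one factor \<open>q\<close> even at order
      \<open>Suc s\<close>; gluing at order s needs the next derivative to vanish at 0 and 1 as
      well.\<close>
    have "q ^ Suc (s + 1 - a) dvd P a"
      unfolding P_def by (rule power_dvd_iterated_pderiv) (use that in simp)
    then obtain r where "P a = q ^ Suc (s + 1 - a) * r" by (auto elim: dvdE)
    then show ?thesis using that(2) by (auto simp: q_def)
  qed
  have "\<exists>M>0. \<forall>t\<in>{0..1}. \<bar>poly (P a) t\<bar> \<le> M" for a
  proof -
    have "bounded (poly (P a) ` {0..1})"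
      by (intro compact_imp_bounded compact_continuous_image) (auto intro!: continuous_intros)
    then show ?thesis by (auto simp: bounded_pos)
  qed
  then obtain M where M: "\<And>a. 0 < M a" "\<And>a t. t \<in> {0..1} \<Longrightarrow> \<bar>poly (P a) t\<bar> \<le> M a"
    by metis
  \<comment> \<open>All orders share one normalisation, so that the \<open>\<phi> a\<close> remain
    successive derivatives of each other.\<close>
  define N where "N = (\<Sum>a\<le>Suc s. M a)"
  have MN: "M a \<le> N" if "a \<le> Suc s" for a
    unfolding N_def using that by (intro member_le_sum) (auto intro: less_imp_le M)
  have N: "0 < N" using MN[of 0] M(1)[of 0] by simp
  define \<phi> where "\<phi> a t = (if t \<in> {0..1} then poly (P a) t else 0) / N" for a t
  show ?thesis
  proof
    show "(\<phi> a has_real_derivative \<phi> (Suc a) t) (at t)" if "a \<le> s" for a t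
    proof -
      have P': "P (Suc a) = pderiv (P a)" by (simp add: P_def)
      have "((\<lambda>t. if t \<in> {0..1} then poly (P a) t else 0) has_real_derivative
           (if t \<in> {0..1} then poly (P (Suc a)) t else 0)) (at t)"
        unfolding P' by (rule has_derivative_poly_cut) (use that P0[of a] P0[of "Suc a"] in \<open>simp_all add: P'\<close>)
      from DERIV_cdivide[OF this, of N] show ?thesis unfolding \<phi>_def .
    qed
    show "\<phi> a t = 0" if "a \<le> Suc s" "t \<notin> {0<..<1}" for a t
      using that P0[of a t] by (cases "t = 0 \<or> t = 1") (auto simp: \<phi>_def)
    show "\<bar>\<phi> a t\<bar> \<le> 1" if "a \<le> Suc s" for a t
      using M(2)[of t a] MN[OF that] N by (auto simp: \<phi>_def)
    have \<phi>0: "\<phi> 0 t = (if t \<in> {0..1} then (t * (1 - t)) ^ (s + 2) / N else 0)" for t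
    proof -
      have "poly q t = t * (1 - t)" by (simp add: q_def algebra_simps)
      then show ?thesis by (simp add: \<phi>_def P_def poly_power)
    qed
    show "0 \<le> \<phi> 0 t" for t
      unfolding \<phi>0 using N by simp
    \<comment> \<open>On the middle half both t and 1 - t are at least 1/4, whence 1/16.\<close>
    show "0 < (1/16) ^ (s + 2) / N" using N by simp
    show "(1/16) ^ (s + 2) / N \<le> \<phi> 0 t" if "t \<in> {1/4..3/4}" for t
    proof -
      have "1/4 * (1/4) \<le> t * (1 - t)" using that by (intro mult_mono) auto
      then have "(1/16) ^ (s + 2) \<le> (t * (1 - t)) ^ (s + 2)" by (intro power_mono) auto
      from divide_right_mono[OF this, of N] show ?thesis unfolding \<phi>0 using that N by simp
    qed
  qed
qed

section \<open>Bump sums in the Hoelder class\<close>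

text \<open>\<open>\<phi> a\<close> stands for the a-th derivative of \<open>\<phi> 0\<close>.
  Bounds reach order \<open>Suc s\<close>, one beyond the order of the class, because they make
  \<open>\<phi> s\<close> Lipschitz, from which every Hoelder exponent up to one follows.\<close>

locale bump =
  fixes \<phi> :: "nat \<Rightarrow> real \<Rightarrow> real" and \<eta> :: real and s :: nat
  assumes \<phi>_deriv: "\<And>a t. a \<le> s \<Longrightarrow> (\<phi> a has_real_derivative \<phi> (Suc a) t) (at t)"
    and \<phi>_zero: "\<And>a t. a \<le> Suc s \<Longrightarrow> t \<notin> {0<..<1} \<Longrightarrow> \<phi> a t = 0"
    and \<phi>_le: "\<And>a t. a \<le> Suc s \<Longrightarrow> \<bar>\<phi> a t\<bar> \<le> 1"
    and \<phi>_nonneg: "\<And>t. 0 \<le> \<phi> 0 t"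
    and \<eta>_pos: "0 < \<eta>"
    and \<phi>_ge: "\<And>t. t \<in> {1/4..3/4} \<Longrightarrow> \<eta> \<le> \<phi> 0 t"
begin

text \<open>This is the \<alpha>-th partial derivative of the product bump on cell j of the grid of
  mesh 1 / m, without the chain rule factor \<open>m ^ mi_order \<alpha>\<close>. Leaving that
  factor out keeps the size at most one for all orders.\<close>

definition cell_bump :: "real \<Rightarrow> ('p::finite \<Rightarrow> nat) \<Rightarrow> ('p \<Rightarrow> nat) \<Rightarrow> real^'p \<Rightarrow> real" where
  "cell_bump m j \<alpha> x = (\<Prod>i\<in>UNIV. \<phi> (\<alpha> i) (m * x $ i - real (j i)))"

lemma cell_bump_nonzeroD:
  assumes "cell_bump m j \<alpha> x \<noteq> 0" "\<And>i. \<alpha> i \<le> s"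
  shows "real (j i) < m * x $ i" "m * x $ i < real (j i) + 1"
proof -
  have "\<phi> (\<alpha> i) (m * x $ i - real (j i)) \<noteq> 0"
    using assms(1) by (auto simp: cell_bump_def)
  with \<phi>_zero[of "\<alpha> i" "m * x $ i - real (j i)"] assms(2)[of i]
  show "real (j i) < m * x $ i" "m * x $ i < real (j i) + 1" by fastforce+
qed

text \<open>Bumps and their derivatives vanish on the faces of the cells, so a nonzero value
  determines every \<open>j i\<close> as the integer part of \<open>m * x $ i\<close>.\<close>

lemma cell_bump_disjoint:
  assumes "cell_bump m j \<alpha> x \<noteq> 0" "cell_bump m j' \<alpha> x \<noteq> 0" "\<And>i. \<alpha> i \<le> s"
  shows "j = j'"
proof
  fix i
  show "j i = j' i"
    using cell_bump_nonzeroD[OF assms(1,3), of i] cell_bump_nonzeroD[OF assms(2,3), of i] by linarith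
qed

lemma abs_cell_bump_le:
  assumes "\<And>i. \<alpha> i \<le> s"
  shows "\<bar>cell_bump m j \<alpha> x\<bar> \<le> 1"
  unfolding cell_bump_def abs_prod
  by (rule prod_le_1) (use assms in \<open>auto intro!: \<phi>_le le_SucI\<close>)

lemma sum_cell_bump_single:
  assumes "finite \<omega>" "j \<in> \<omega>" "cell_bump m j \<alpha> x \<noteq> 0" "\<And>i. \<alpha> i \<le> s"
  shows "(\<Sum>j\<in>\<omega>. cell_bump m j \<alpha> x) = cell_bump m j \<alpha> x"
proof -
  have "(\<Sum>j\<in>\<omega>. cell_bump m j \<alpha> x) = (\<Sum>j\<in>{j}. cell_bump m j \<alpha> x)"
    by (rule sum.mono_neutral_right) (use assms cell_bump_disjoint in \<open>blast+\<close>)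
  then show ?thesis by simp
qed

lemma abs_sum_cell_bump_le:
  assumes "finite \<omega>" "\<And>i. \<alpha> i \<le> s"
  shows "\<bar>\<Sum>j\<in>\<omega>. cell_bump m j \<alpha> x\<bar> \<le> 1"
proof (cases "\<exists>j\<in>\<omega>. cell_bump m j \<alpha> x \<noteq> 0")
  case True
  then show ?thesis
    using sum_cell_bump_single[where \<omega> = \<omega>] abs_cell_bump_le assms by metis
qed simp

lemma \<phi>_lipschitz:
  assumes "a \<le> s"
  shows "\<bar>\<phi> a t - \<phi> a u\<bar> \<le> \<bar>t - u\<bar>"
proof -
  have "norm (\<phi> a t - \<phi> a u) \<le> 1 * norm (t - u)"
    by (rule field_differentiable_bound[where S = UNIV and f' = "\<phi> (Suc a)"])
      (use assms in \<open>auto intro: \<phi>_deriv \<phi>_le\<close>)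
  then show ?thesis by simp
qed

text \<open>As all factors have modulus at most one, a difference of products is at most the sum of
  the differences of the factors, one for each coordinate.\<close>

lemma cell_bump_lipschitz:
  fixes x y :: "real^'p::finite"
  assumes "0 \<le> m" "\<And>i. \<alpha> i \<le> s"
  shows "\<bar>cell_bump m j \<alpha> x - cell_bump m j \<alpha> y\<bar> \<le> real CARD('p) * (m * norm (x - y))"
proof -
  have le: "\<bar>\<phi> (\<alpha> i) t\<bar> \<le> 1" for i t using \<phi>_le assms(2) le_SucI by blast
  have "\<bar>cell_bump m j \<alpha> x - cell_bump m j \<alpha> y\<bar> \<le>
      (\<Sum>i\<in>UNIV. \<bar>\<phi> (\<alpha> i) (m * x $ i - real (j i)) - \<phi> (\<alpha> i) (m * y $ i - real (j i))\<bar>)"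
    unfolding cell_bump_def real_norm_def[symmetric] by (rule norm_prod_diff) (simp_all add: le)
  also have "\<dots> \<le> (\<Sum>i\<in>(UNIV::'p set). m * norm (x - y))"
  proof (rule sum_mono)
    fix i
    have "\<bar>\<phi> (\<alpha> i) (m * x $ i - real (j i)) - \<phi> (\<alpha> i) (m * y $ i - real (j i))\<bar> \<le> \<bar>m * (x - y) $ i\<bar>"
      using \<phi>_lipschitz[OF assms(2)[of i], of "m * x $ i - real (j i)" "m * y $ i - real (j i)"]
      by (simp add: right_diff_distrib)
    also have "\<dots> \<le> m * norm (x - y)"
      using component_le_norm_cart[of "x - y" i] assms(1) by (simp add: abs_mult mult_left_mono)
    finally show "\<bar>\<phi> (\<alpha> i) (m * x $ i - real (j i)) - \<phi> (\<alpha> i) (m * y $ i - real (j i))\<bar> \<le> \<dots>" .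
  qed
  finally show ?thesis by simp
qed

text \<open>Interpolation between two trivial bounds at the scale of the mesh: for
  \<open>z = m * norm (x - y)\<close> at most one the Lipschitz bound applies and z is below
  \<open>z powr r\<close>; for larger z the bound 2 on the difference suffices.\<close>

lemma cell_bump_holder:
  fixes x y :: "real^'p::finite"
  assumes "0 \<le> m" "\<And>i. \<alpha> i \<le> s" "0 < r" "r \<le> 1"
  shows "\<bar>cell_bump m j \<alpha> x - cell_bump m j \<alpha> y\<bar> \<le> 2 * real CARD('p) * (m * norm (x - y)) powr r"
proof -
  let ?z = "m * norm (x - y)" and ?d = "\<bar>cell_bump m j \<alpha> x - cell_bump m j \<alpha> y\<bar>"
  have z: "0 \<le> ?z" using assms(1) by simp
  have p: "1 \<le> real CARD('p)" by (simp add: Suc_le_eq)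
  show ?thesis
  proof (cases "?z \<le> 1")
    case True
    have "?z \<le> ?z powr r"
    proof (cases "?z = 0")
      case True
      then show ?thesis by (metis powr_ge_zero)
    next
      case False
      with z \<open>?z \<le> 1\<close> assms(4) have "?z powr 1 \<le> ?z powr r" by (intro powr_mono') auto
      with z show ?thesis by simp
    qed
    then have "real CARD('p) * ?z \<le> 2 * real CARD('p) * ?z powr r"
      using p z by (intro mult_mono) auto
    then show ?thesis by (rule order_trans[OF cell_bump_lipschitz[OF assms(1,2)]])
  next
    case False
    then have "1 \<le> ?z powr r" using assms(3) by (intro ge_one_powr_ge_zero) auto
    then have "2 * 1 * 1 \<le> 2 * real CARD('p) * ?z powr r" using p by (intro mult_mono) auto
    moreover have "\<bar>cell_bump m j \<alpha> z\<bar> \<le> 1" for z :: "real^'p"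
      by (rule abs_cell_bump_le[OF assms(2)])
    from this[of x] this[of y] have "?d \<le> 2" by linarith
    ultimately show ?thesis by linarith
  qed
qed

text \<open>At each of x and y at most one bump is nonzero, so at most two summands of the
  difference survive, however many cells \<omega> has. This makes the constant independent of
  m.\<close>

lemma sum_cell_bump_holder:
  fixes x y :: "real^'p::finite"
  assumes "finite \<omega>" "0 \<le> m" "\<And>i. \<alpha> i \<le> s" "0 < r" "r \<le> 1"
  shows "\<bar>(\<Sum>j\<in>\<omega>. cell_bump m j \<alpha> x) - (\<Sum>j\<in>\<omega>. cell_bump m j \<alpha> y)\<bar>
    \<le> 4 * real CARD('p) * (m * norm (x - y)) powr r"
proof -
  let ?K = "2 * real CARD('p) * (m * norm (x - y)) powr r"
  define N where "N z = {j\<in>\<omega>. cell_bump m j \<alpha> z \<noteq> 0}" for z :: "real^'p"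
  have fin: "finite (N z)" for z using assms(1) by (simp add: N_def)
  have card: "card (N z) \<le> Suc 0" for z
    unfolding card_le_Suc0_iff_eq[OF fin] by (auto simp: N_def intro: cell_bump_disjoint assms(3))
  have "\<bar>(\<Sum>j\<in>\<omega>. cell_bump m j \<alpha> x) - (\<Sum>j\<in>\<omega>. cell_bump m j \<alpha> y)\<bar>
      = \<bar>\<Sum>j\<in>\<omega>. cell_bump m j \<alpha> x - cell_bump m j \<alpha> y\<bar>"
    by (simp add: sum_subtractf)
  also have "(\<Sum>j\<in>\<omega>. cell_bump m j \<alpha> x - cell_bump m j \<alpha> y)
      = (\<Sum>j\<in>N x \<union> N y. cell_bump m j \<alpha> x - cell_bump m j \<alpha> y)"
    by (rule sum.mono_neutral_right) (auto simp: assms(1) N_def)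
  also have "\<bar>\<dots>\<bar> \<le> real (card (N x \<union> N y)) * ?K"
    using sum_norm_bound[of "N x \<union> N y" "\<lambda>j. cell_bump m j \<alpha> x - cell_bump m j \<alpha> y" ?K]
      cell_bump_holder[OF assms(2) _ assms(4,5), of \<alpha> _ x y] assms(3) by auto
  also have "\<dots> \<le> 2 * ?K"
  proof (rule mult_right_mono)
    show "real (card (N x \<union> N y)) \<le> 2"
      using card_Un_le[of "N x" "N y"] card[of x] card[of y] by linarith
  qed simp
  finally show ?thesis by simp
qed

lemma cell_bump_partial_deriv:
  assumes "\<alpha> i \<le> s"
  shows "((\<lambda>t. cell_bump m j \<alpha> (x + t *\<^sub>R axis i 1)) has_real_derivative
      m * cell_bump m j (\<alpha>(i := Suc (\<alpha> i))) x) (at 0 within S)"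
proof -
  define R where "R = (\<Prod>k\<in>UNIV - {i}. \<phi> (\<alpha> k) (m * x $ k - real (j k)))"
  have line: "cell_bump m j \<alpha> (x + t *\<^sub>R axis i 1) = \<phi> (\<alpha> i) (m * (x $ i + t) - real (j i)) * R" for t
    unfolding cell_bump_def R_def
    by (subst prod.remove[of UNIV i]) (auto simp: axis_def intro!: prod.cong)
  have upd: "cell_bump m j (\<alpha>(i := Suc (\<alpha> i))) x = \<phi> (Suc (\<alpha> i)) (m * x $ i - real (j i)) * R"
    unfolding cell_bump_def R_def by (subst prod.remove[of UNIV i]) (auto intro!: prod.cong)
  have "((\<lambda>t. \<phi> (\<alpha> i) (m * (x $ i + t) - real (j i))) has_real_derivative
      \<phi> (Suc (\<alpha> i)) (m * (x $ i + 0) - real (j i)) * m) (at 0)"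
    by (rule DERIV_chain2[OF \<phi>_deriv[OF assms]]) (auto intro!: derivative_eq_intros)
  from DERIV_cmult_right[OF this, of R] show ?thesis
    unfolding line upd by (simp add: mult_ac has_field_derivative_at_within)
qed

text \<open>The scaling is exact at the top order: s derivatives produce \<open>m ^ s\<close>, the
  Hoelder quotient produces \<open>m powr (\<beta> - s)\<close>, and the amplitude
  \<open>m powr (- \<beta>)\<close> cancels both. Lower orders are smaller since m is at least
  one.\<close>

lemma bump_sum_in_holder_class:
  fixes \<omega> :: "('p::finite \<Rightarrow> nat) set"
  assumes "0 < \<beta>" "s = smoothness_order \<beta>" "finite \<omega>" "1 \<le> m" "0 \<le> c"
    and B: "\<bar>a\<bar> + 4 * real CARD('p) * c \<le> B"
  shows "(\<lambda>x. a + c * m powr (- \<beta>) * (\<Sum>j\<in>\<omega>. cell_bump m j (\<lambda>_. 0) x)) \<in> holder_class \<beta> X B"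
proof -
  define G :: "('p \<Rightarrow> nat) \<Rightarrow> real^'p \<Rightarrow> real" where
    "G \<alpha> x = (if \<alpha> = (\<lambda>_. 0) then a else 0)
       + c * m powr (real (mi_order \<alpha>) - \<beta>) * (\<Sum>j\<in>\<omega>. cell_bump m j \<alpha> x)" for \<alpha> x
  \<comment> \<open>For an integer \<beta> the order is \<beta> - 1, so the Hoelder exponent \<beta>
    - s lies in (0, 1] and is one in that case.\<close>
  have s: "real s < \<beta>" "\<beta> - real s \<le> 1"
    using assms(1) unfolding assms(2) smoothness_order_def by linarith+
  have le_mi: "\<alpha> i \<le> mi_order \<alpha>" for \<alpha> :: "'p \<Rightarrow> nat" and i
    unfolding mi_order_def by (rule member_le_sum) auto
  have p: "1 \<le> real CARD('p)" by (simp add: Suc_le_eq)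
  then have "1 * c \<le> 4 * real CARD('p) * c" using assms(5) by (intro mult_right_mono) linarith+
  with B have Bc: "\<bar>a\<bar> + c \<le> B" by simp
  have "partial_derivs X s (\<lambda>x. a + c * m powr (- \<beta>) * (\<Sum>j\<in>\<omega>. cell_bump m j (\<lambda>_. 0) x)) G"
    unfolding partial_derivs_def
  proof (intro conjI allI impI ballI)
    show "G (\<lambda>_. 0) x = a + c * m powr (- \<beta>) * (\<Sum>j\<in>\<omega>. cell_bump m j (\<lambda>_. 0) x)" for x
      by (simp add: G_def mi_order_def)
  next
    fix \<alpha> :: "'p \<Rightarrow> nat" and i x assume lt: "mi_order \<alpha> < s"
    have "mi_order (\<alpha>(i := Suc (\<alpha> i))) = Suc (\<alpha> i) + (\<Sum>k\<in>UNIV - {i}. \<alpha> k)"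
      unfolding mi_order_def by (subst sum.remove[of UNIV i]) (auto intro!: sum.cong)
    also have "\<dots> = Suc (mi_order \<alpha>)"
      unfolding mi_order_def by (subst sum.remove[of UNIV i \<alpha>]) auto
    finally have upd: "mi_order (\<alpha>(i := Suc (\<alpha> i))) = Suc (mi_order \<alpha>)" .
    have powr: "m powr (real (Suc (mi_order \<alpha>)) - \<beta>) = m powr (real (mi_order \<alpha>) - \<beta>) * m"
      using powr_add[of m "real (mi_order \<alpha>) - \<beta>" 1] assms(4) by (simp add: algebra_simps)
    \<comment> \<open>The constant a sits in \<open>G\<close> at the zero index only, hence
      disappears after one differentiation.\<close>
    have ne: "\<alpha>(i := Suc (\<alpha> i)) \<noteq> (\<lambda>_. 0)"
    proof
      assume "\<alpha>(i := Suc (\<alpha> i)) = (\<lambda>_. 0)"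
      from fun_cong[OF this, of i] show False by simp
    qed
    have "\<alpha> i \<le> s" using le_mi[of \<alpha> i] lt by simp
    then have "((\<lambda>t. G \<alpha> (x + t *\<^sub>R axis i 1)) has_real_derivative
        0 + c * m powr (real (mi_order \<alpha>) - \<beta>) * (\<Sum>j\<in>\<omega>. m * cell_bump m j (\<alpha>(i := Suc (\<alpha> i))) x))
        (at 0 within {t. x + t *\<^sub>R axis i 1 \<in> X})"
      unfolding G_def by (intro DERIV_add DERIV_const DERIV_cmult DERIV_sum cell_bump_partial_deriv)
    also have "0 + c * m powr (real (mi_order \<alpha>) - \<beta>) * (\<Sum>j\<in>\<omega>. m * cell_bump m j (\<alpha>(i := Suc (\<alpha> i))) x)
        = G (\<alpha>(i := Suc (\<alpha> i))) x"
      unfolding G_def upd powr using ne by (simp add: sum_distrib_left mult_ac)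
    finally show "((\<lambda>t. G \<alpha> (x + t *\<^sub>R axis i 1)) has_real_derivative G (\<alpha>(i := Suc (\<alpha> i))) x)
        (at 0 within {t. x + t *\<^sub>R axis i 1 \<in> X})" .
  qed
  moreover have "\<bar>G \<alpha> x\<bar> \<le> B" if "mi_order \<alpha> \<le> s" for \<alpha> x
  proof -
    have "\<And>i. \<alpha> i \<le> s" using le_mi[of \<alpha>] that by (meson le_trans)
    from abs_sum_cell_bump_le[OF assms(3) this]
    have S: "\<bar>\<Sum>j\<in>\<omega>. cell_bump m j \<alpha> x\<bar> \<le> 1" .
    have "m powr (real (mi_order \<alpha>) - \<beta>) \<le> m powr 0"
      using assms(4) s(1) that by (intro powr_mono) auto
    then have "m powr (real (mi_order \<alpha>) - \<beta>) \<le> 1" using assms(4) by simp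
    then have "c * m powr (real (mi_order \<alpha>) - \<beta>) * \<bar>\<Sum>j\<in>\<omega>. cell_bump m j \<alpha> x\<bar> \<le> c * 1 * 1"
      using S assms(5) by (intro mult_mono) auto
    then have "\<bar>c * m powr (real (mi_order \<alpha>) - \<beta>) * (\<Sum>j\<in>\<omega>. cell_bump m j \<alpha> x)\<bar> \<le> c"
      using assms(5) by (simp add: abs_mult)
    with Bc assms(5) show ?thesis unfolding G_def by (auto intro: order_trans[OF abs_triangle_ineq])
  qed
  moreover have "\<bar>G \<alpha> x - G \<alpha> y\<bar> / norm (x - y) powr (\<beta> - real s) \<le> B"
    if "mi_order \<alpha> = s" "x \<noteq> y" for \<alpha> x y
  proof -
    have "\<And>i. \<alpha> i \<le> s" using le_mi[of \<alpha>] that by simp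
    have "\<bar>(\<Sum>j\<in>\<omega>. cell_bump m j \<alpha> x) - (\<Sum>j\<in>\<omega>. cell_bump m j \<alpha> y)\<bar>
        \<le> 4 * real CARD('p) * (m * norm (x - y)) powr (\<beta> - real s)"
      by (rule sum_cell_bump_holder) (use assms s \<open>\<And>i. \<alpha> i \<le> s\<close> in auto)
    also have "\<dots> = 4 * real CARD('p) * (m powr (\<beta> - real s) * norm (x - y) powr (\<beta> - real s))"
      using assms(4) by (simp add: powr_mult)
    finally have le: "\<bar>(\<Sum>j\<in>\<omega>. cell_bump m j \<alpha> x) - (\<Sum>j\<in>\<omega>. cell_bump m j \<alpha> y)\<bar> \<le> \<dots>" .
    have "G \<alpha> x - G \<alpha> y = c * m powr (real s - \<beta>) *
        ((\<Sum>j\<in>\<omega>. cell_bump m j \<alpha> x) - (\<Sum>j\<in>\<omega>. cell_bump m j \<alpha> y))"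
      unfolding G_def that(1) by (simp add: right_diff_distrib)
    then have "\<bar>G \<alpha> x - G \<alpha> y\<bar> = c * m powr (real s - \<beta>) *
        \<bar>(\<Sum>j\<in>\<omega>. cell_bump m j \<alpha> x) - (\<Sum>j\<in>\<omega>. cell_bump m j \<alpha> y)\<bar>"
      using assms(5) by (simp add: abs_mult)
    also have "\<dots> \<le> c * m powr (real s - \<beta>) *
        (4 * real CARD('p) * (m powr (\<beta> - real s) * norm (x - y) powr (\<beta> - real s)))"
      using le assms(5) by (intro mult_left_mono) auto
    also have "\<dots> = 4 * real CARD('p) * c * (m powr (real s - \<beta>) * m powr (\<beta> - real s))
        * norm (x - y) powr (\<beta> - real s)"
      by (simp add: mult_ac)
    also have "m powr (real s - \<beta>) * m powr (\<beta> - real s) = 1"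
      using assms(4) by (simp flip: powr_add)
    also have "4 * real CARD('p) * c * 1 * norm (x - y) powr (\<beta> - real s)
        \<le> B * norm (x - y) powr (\<beta> - real s)"
      using B by (intro mult_right_mono) auto
    finally show ?thesis using that(2) by (simp add: divide_le_eq)
  qed
  ultimately show ?thesis unfolding holder_class_def assms(2) by blast
qed

end

section \<open>Tilted uniform distributions\<close>

text \<open>The factor \<open>1 - 2 * d / w\<close> has mean zero under the uniform law on
  \<open>[0, w]\<close>, so every tilt preserves total mass one.\<close>

definition tilted_density :: "real \<Rightarrow> real \<Rightarrow> real \<Rightarrow> real" where
  "tilted_density w \<theta> d = indicator {0..w} d * ((1 + \<theta> * (1 - 2 * d / w)) / w)"

definition tilted :: "real \<Rightarrow> real \<Rightarrow> real measure" where
  "tilted w \<theta> = density lborel (\<lambda>d. ennreal (tilted_density w \<theta> d))"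

text \<open>An antiderivative of the density on \<open>[0, w]\<close>. It is not clipped outside, so
  it equals the distribution function only for t in \<open>[0, w]\<close>.\<close>

definition tilted_cdf :: "real \<Rightarrow> real \<Rightarrow> real \<Rightarrow> real" where
  "tilted_cdf w \<theta> t = t / w + \<theta> * (t / w) * (1 - t / w)"

lemma tilted_density_measurable [measurable]:
  assumes [measurable]: "\<theta> \<in> borel_measurable M" "d \<in> borel_measurable M"
  shows "(\<lambda>x. tilted_density w (\<theta> x) (d x)) \<in> borel_measurable M"
  unfolding tilted_density_def by measurable

lemma sets_tilted [simp, measurable_cong]: "sets (tilted w \<theta>) = sets borel"
  and space_tilted [simp]: "space (tilted w \<theta>) = UNIV"
  by (simp_all add: tilted_def)

locale tilt =
  fixes w \<theta> :: real
  assumes w: "0 < w" and \<theta>: "\<bar>\<theta>\<bar> \<le> 1 / 2"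
begin

lemma slope_bound:
  assumes "0 \<le> d" "d \<le> w"
  shows "1 / 2 \<le> 1 + \<theta> * (1 - 2 * d / w)"
proof -
  have "\<bar>1 - 2 * d / w\<bar> \<le> 1" using assms w by (auto simp: abs_le_iff field_simps)
  then have "\<bar>\<theta>\<bar> * \<bar>1 - 2 * d / w\<bar> \<le> 1 / 2 * 1" using \<theta> by (intro mult_mono) auto
  then have "\<bar>\<theta> * (1 - 2 * d / w)\<bar> \<le> 1 / 2" by (simp add: abs_mult)
  then show ?thesis unfolding abs_le_iff by linarith
qed

lemma tilted_density_ge:
  assumes "0 \<le> d" "d \<le> w"
  shows "1 / (2 * w) \<le> tilted_density w \<theta> d"
  using divide_right_mono[OF slope_bound[OF assms], of w] w assms by (simp add: tilted_density_def)

lemma tilted_density_nonneg: "0 \<le> tilted_density w \<theta> d"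
proof (cases "0 \<le> d \<and> d \<le> w")
  case True
  then have "0 \<le> 1 / (2 * w)" using w by simp
  also have "\<dots> \<le> tilted_density w \<theta> d" using True by (intro tilted_density_ge) auto
  finally show ?thesis .
qed (simp add: tilted_density_def)

lemma nn_integral_tilted_Icc:
  assumes "0 \<le> a" "a \<le> b" "b \<le> w"
  shows "(\<integral>\<^sup>+d. ennreal ((1 + \<theta> * (1 - 2 * d / w)) / w) * indicator {a..b} d \<partial>lborel)
    = ennreal (tilted_cdf w \<theta> b - tilted_cdf w \<theta> a)"
proof (rule nn_integral_FTC_Icc)
  fix d assume d: "d \<in> {a..b}"
  show "DERIV (tilted_cdf w \<theta>) d :> (1 + \<theta> * (1 - 2 * d / w)) / w"
    unfolding tilted_cdf_def
    by (rule derivative_eq_intros refl | use w in \<open>simp add: field_simps\<close>)+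
  show "0 \<le> (1 + \<theta> * (1 - 2 * d / w)) / w"
  proof (rule divide_nonneg_pos[OF _ w])
    have "1 / 2 \<le> 1 + \<theta> * (1 - 2 * d / w)" using d assms by (intro slope_bound) auto
    then show "0 \<le> 1 + \<theta> * (1 - 2 * d / w)" by linarith
  qed
qed (use assms in auto)

lemma emeasure_tilted_Icc:
  assumes "0 \<le> a" "a \<le> b" "b \<le> w"
  shows "emeasure (tilted w \<theta>) {a..b} = ennreal (tilted_cdf w \<theta> b - tilted_cdf w \<theta> a)"
  unfolding nn_integral_tilted_Icc[OF assms, symmetric] tilted_def
  by (subst emeasure_density) (use assms in \<open>auto intro!: nn_integral_cong simp: tilted_density_def split: split_indicator\<close>)

lemma emeasure_tilted_atMost:
  assumes "0 \<le> t" "t \<le> w"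
  shows "emeasure (tilted w \<theta>) {..t} = ennreal (tilted_cdf w \<theta> t)"
proof -
  have "emeasure (tilted w \<theta>) {..t} = ennreal (tilted_cdf w \<theta> t - tilted_cdf w \<theta> 0)"
    unfolding nn_integral_tilted_Icc[OF order_refl assms, symmetric] tilted_def
    by (subst emeasure_density) (use assms in \<open>auto intro!: nn_integral_cong simp: tilted_density_def split: split_indicator\<close>)
  then show ?thesis by (simp add: tilted_cdf_def)
qed

lemma prob_space_tilted: "prob_space (tilted w \<theta>)"
proof
  have "emeasure (tilted w \<theta>) UNIV = ennreal (tilted_cdf w \<theta> w - tilted_cdf w \<theta> 0)"
    unfolding nn_integral_tilted_Icc[OF order_refl less_imp_le[OF w] order_refl, symmetric] tilted_def
    by (subst emeasure_density) (auto intro!: nn_integral_cong simp: tilted_density_def split: split_indicator)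
  then show "emeasure (tilted w \<theta>) (space (tilted w \<theta>)) = 1"
    using w by (simp add: tilted_cdf_def)
qed

sublocale prob_space "tilted w \<theta>" by (rule prob_space_tilted)

lemma tilted_cdf_diff_ge:
  assumes "0 \<le> a" "a \<le> b" "b \<le> w"
  shows "(b - a) / (2 * w) \<le> tilted_cdf w \<theta> b - tilted_cdf w \<theta> a"
proof -
  \<comment> \<open>The distribution function is quadratic on \<open>[0, w]\<close>, so its
    increment is exactly the length times the density at the midpoint.\<close>
  have "1 / 2 \<le> 1 + \<theta> * (1 - 2 * ((a + b) / 2) / w)"
    using assms by (intro slope_bound) auto
  then have "(b - a) / w * (1 / 2) \<le> (b - a) / w * (1 + \<theta> * (1 - 2 * ((a + b) / 2) / w))"
    using assms w by (intro mult_left_mono) auto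
  also have "\<dots> = tilted_cdf w \<theta> b - tilted_cdf w \<theta> a"
    using w by (simp add: tilted_cdf_def field_simps)
  finally show ?thesis by (simp add: mult.commute)
qed

lemma tilted_cdf_nonneg: "0 \<le> t \<Longrightarrow> t \<le> w \<Longrightarrow> 0 \<le> tilted_cdf w \<theta> t"
  using tilted_cdf_diff_ge[of 0 t] w by (simp add: tilted_cdf_def) (smt (verit) divide_nonneg_pos)

lemma cdf_tilted: "0 \<le> t \<Longrightarrow> t \<le> w \<Longrightarrow> cdf (tilted w \<theta>) t = tilted_cdf w \<theta> t"
  unfolding cdf_def measure_def by (simp add: emeasure_tilted_atMost tilted_cdf_nonneg)

text \<open>A density bounded below makes the distribution function strictly increasing on
  \<open>[0, w]\<close>, so no smaller point reaches the same level.\<close>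

lemma quantile_tilted:
  assumes q: "0 \<le> q" "q \<le> w"
  shows "Inf {t. 0 \<le> t \<and> tilted_cdf w \<theta> q \<le> cdf (tilted w \<theta>) t} = q"
proof -
  have "{t. 0 \<le> t \<and> tilted_cdf w \<theta> q \<le> cdf (tilted w \<theta>) t} = {q..}"
  proof (intro equalityI subsetI; clarsimp)
    fix t assume t: "0 \<le> t" "tilted_cdf w \<theta> q \<le> cdf (tilted w \<theta>) t"
    show "q \<le> t"
    proof (rule ccontr)
      assume "\<not> q \<le> t"
      then have lt: "t < q" by simp
      then have "0 < (q - t) / (2 * w)" using w by simp
      with tilted_cdf_diff_ge[of t q] t lt q cdf_tilted[of t] show False by simp
    qed
  next
    fix t assume t: "q \<le> t"
    have "cdf (tilted w \<theta>) q \<le> cdf (tilted w \<theta>) t"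
      unfolding cdf_def using t by (intro finite_measure_mono) auto
    then show "0 \<le> t \<and> tilted_cdf w \<theta> q \<le> cdf (tilted w \<theta>) t" using t q by (simp add: cdf_tilted)
  qed
  then show ?thesis by simp
qed

lemma emeasure_tilted_outside: "emeasure (tilted w \<theta>) (- {0..w}) = 0"
  unfolding tilted_def by (subst emeasure_density)
    (auto intro!: nn_integral_zero' AE_I2 simp: tilted_density_def split: split_indicator)

lemma msupport_tilted: "msupport (tilted w \<theta>) \<subseteq> {0..w}"
proof (rule ccontr)
  assume "\<not> msupport (tilted w \<theta>) \<subseteq> {0..w}"
  then obtain x where x: "x \<in> msupport (tilted w \<theta>)" "x \<in> - {0..w}" by blast
  have "open (- {0..w})" by (intro open_Compl) simp
  with x have pos: "0 < emeasure (tilted w \<theta>) (- {0..w})" unfolding msupport_def by blast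
  with emeasure_tilted_outside show False by simp
qed

lemma distributed_tilted: "distributed (tilted w \<theta>) lborel (\<lambda>d. d) (\<lambda>d. ennreal (tilted_density w \<theta> d))"
proof -
  have "distr (tilted w \<theta>) lborel (\<lambda>d. d) = tilted w \<theta>"
    by (rule distr_id2) simp
  then show ?thesis unfolding distributed_def by (simp add: tilted_def)
qed

end

section \<open>Quadratic growth of the newsvendor risk around the quantile\<close>

definition loss :: "real \<Rightarrow> real \<Rightarrow> real \<Rightarrow> real \<Rightarrow> real" where
  "loss b h d y = b * max (d - y) 0 + h * max (y - d) 0"

lemma loss_measurable [measurable]:
  assumes [measurable]: "f \<in> borel_measurable M" "g \<in> borel_measurable M"
  shows "(\<lambda>x. loss b h (f x) (g x)) \<in> borel_measurable M"
  unfolding loss_def by measurable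

text \<open>Pointwise form of the growth for predictions above q. Moving from q to y costs
  \<open>(y - q) * h\<close> for demands up to q and saves at most \<open>(y - q) * b\<close> for
  the others; for d between q and y the true saving is smaller by \<open>(b + h) * (y - d)\<close>,
  which is at least \<open>(b + h) * (t / 2)\<close> on the window. Terms are arranged so that both
  sides are nonnegative and can be integrated in \<open>ennreal\<close>.\<close>

lemma loss_gap_right:
  assumes "0 < b" "0 < h" "0 < t" "q + t \<le> y"
  shows "loss b h d q + (y - q) * h * indicator {..q} d + (b + h) * (t / 2) * indicator {q + t / 4..q + t / 2} d
    \<le> loss b h d y + (y - q) * b * indicator (- {..q}) d"
proof -
  consider "d \<le> q" | "q < d" "d \<le> y" "d \<in> {q + t / 4..q + t / 2}" | "q < d" "d \<le> y" "d \<notin> {q + t / 4..q + t / 2}"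
    | "y < d" "q < d"
    using assms by linarith
  then show ?thesis
  proof cases
    case 2
    then have "0 \<le> (b + h) * (y - d - t / 2)" using assms by (intro mult_nonneg_nonneg) auto
    with 2 show ?thesis using assms by (simp add: loss_def max_def algebra_simps)
  next
    case 3
    then have "0 \<le> (b + h) * (y - d)" using assms by (intro mult_nonneg_nonneg) auto
    with 3 show ?thesis using assms by (simp add: loss_def max_def algebra_simps)
  qed (use assms in \<open>auto simp: loss_def max_def algebra_simps\<close>)
qed

text \<open>Mirror image of the previous bound, with the roles of b and h exchanged.\<close>

lemma loss_gap_left:
  assumes "0 < b" "0 < h" "0 < t" "y \<le> q - t"
  shows "loss b h d q + (q - y) * b * indicator (- {..q}) d + (b + h) * (t / 2) * indicator {q - t / 2..q - t / 4} d
    \<le> loss b h d y + (q - y) * h * indicator {..q} d"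
proof -
  consider "q < d" | "d \<le> q" "y < d" "d \<in> {q - t / 2..q - t / 4}" | "d \<le> q" "y < d" "d \<notin> {q - t / 2..q - t / 4}"
    | "d \<le> y"
    using assms by linarith
  then show ?thesis
  proof cases
    case 2
    then have "0 \<le> (b + h) * (d - y - t / 2)" using assms by (intro mult_nonneg_nonneg) auto
    with 2 show ?thesis using assms by (simp add: loss_def max_def algebra_simps)
  next
    case 3
    then have "0 \<le> (b + h) * (d - y)" using assms by (intro mult_nonneg_nonneg) auto
    with 3 show ?thesis using assms by (simp add: loss_def max_def algebra_simps)
  qed (use assms in \<open>auto simp: loss_def max_def algebra_simps\<close>)
qed

context tilt
begin

text \<open>Integrating the pointwise bound, the linear terms cancel at the quantile and the window
  remains: it has length t / 4, hence mass at least \<open>t / (8 * w)\<close>, and a gain of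
  \<open>(b + h) * (t / 2)\<close> on it. This is where 16 comes from. The conditions on t keep the
  window inside \<open>[0, w]\<close>.\<close>

lemma tilted_excess_risk:
  assumes bh: "0 < b" "0 < h" and q: "tilted_cdf w \<theta> q = b / (b + h)"
    and t: "0 < t" "t \<le> q" "q + t \<le> w" and y: "t \<le> \<bar>y - q\<bar>"
  shows "(\<integral>\<^sup>+d. ennreal (loss b h d q) \<partial>tilted w \<theta>) + ennreal ((b + h) * t\<^sup>2 / (16 * w))
    \<le> (\<integral>\<^sup>+d. ennreal (loss b h d y) \<partial>tilted w \<theta>)"
proof -
  let ?K = "tilted w \<theta>"
  define R where "R y = (\<integral>\<^sup>+d. ennreal (loss b h d y) \<partial>?K)" for y
  have qw: "0 \<le> q" "q \<le> w" using t by auto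
  have nonneg: "0 \<le> loss b h d y" for d y using bh by (simp add: loss_def)
  have below: "emeasure ?K {..q} = ennreal (b / (b + h))"
    using emeasure_tilted_atMost[OF qw] q by simp
  have above: "emeasure ?K (- {..q}) = ennreal (h / (b + h))"
  proof -
    have "emeasure ?K (- {..q}) = 1 - emeasure ?K {..q}"
      using emeasure_compl[of "{..q}" ?K] emeasure_space_1 by (simp add: Compl_eq_Diff_UNIV)
    also have "\<dots> = ennreal (1 - b / (b + h))"
      unfolding below using bh ennreal_minus[of "b / (b + h)" 1] by simp
    also have "1 - b / (b + h) = h / (b + h)" using bh by (simp add: field_simps)
    finally show ?thesis .
  qed
  \<comment> \<open>Serves both sides of q: \<open>A\<close> and \<open>A'\<close> are the two
    half-lines, and \<open>eq\<close> says that the linear terms have the same finite integral, so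
    they can be cancelled.\<close>
  have key: "R q + ennreal ((b + h) * t\<^sup>2 / (16 * w)) \<le> R y"
    if le: "\<And>d. loss b h d q + \<delta> * c * indicator A d + (b + h) * (t / 2) * indicator {u..v} d
        \<le> loss b h d y + \<delta> * c' * indicator A' d"
      and A: "A \<in> sets borel" "A' \<in> sets borel"
      and eq: "ennreal (\<delta> * c) * emeasure ?K A = ennreal (\<delta> * c') * emeasure ?K A'"
      and uv: "0 \<le> u" "u \<le> v" "v \<le> w" "v - u = t / 4" and c: "0 \<le> \<delta> * c" "0 \<le> \<delta> * c'"
    for A A' \<delta> c c' u v
  proof -
    have mass: "ennreal (t / (8 * w)) \<le> emeasure ?K {u..v}"
      unfolding emeasure_tilted_Icc[OF uv(1-3)]
      using tilted_cdf_diff_ge[OF uv(1-3)] uv(4) by (intro ennreal_leI) (simp add: field_simps)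
    have "ennreal ((b + h) * t\<^sup>2 / (16 * w)) = ennreal ((b + h) * (t / 2)) * ennreal (t / (8 * w))"
      using bh t w by (subst ennreal_mult[symmetric]) (auto simp: power2_eq_square)
    also have "\<dots> \<le> ennreal ((b + h) * (t / 2)) * emeasure ?K {u..v}"
      using mass by (rule mult_left_mono) simp
    finally have "R q + ennreal (\<delta> * c) * emeasure ?K A + ennreal ((b + h) * t\<^sup>2 / (16 * w))
       \<le> R q + ennreal (\<delta> * c) * emeasure ?K A + ennreal ((b + h) * (t / 2)) * emeasure ?K {u..v}"
      by (rule add_left_mono)
    also have "\<dots> = (\<integral>\<^sup>+d. ennreal (loss b h d q) + ennreal (\<delta> * c) * indicator A d
        + ennreal ((b + h) * (t / 2)) * indicator {u..v} d \<partial>?K)"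
      using A unfolding R_def by (simp add: nn_integral_add nn_integral_cmult)
    also have "\<dots> = (\<integral>\<^sup>+d. ennreal (loss b h d q + \<delta> * c * indicator A d + (b + h) * (t / 2) * indicator {u..v} d) \<partial>?K)"
      using c bh t nonneg
      by (intro nn_integral_cong) (auto simp: ennreal_plus[symmetric] split: split_indicator simp del: ennreal_plus)
    also have "\<dots> \<le> (\<integral>\<^sup>+d. ennreal (loss b h d y + \<delta> * c' * indicator A' d) \<partial>?K)"
      using le by (intro nn_integral_mono ennreal_leI)
    also have "\<dots> = (\<integral>\<^sup>+d. ennreal (loss b h d y) + ennreal (\<delta> * c') * indicator A' d \<partial>?K)"
      using c nonneg
      by (intro nn_integral_cong) (auto simp: ennreal_plus[symmetric] split: split_indicator simp del: ennreal_plus)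
    also have "\<dots> = R y + ennreal (\<delta> * c') * emeasure ?K A'"
      using A unfolding R_def by (simp add: nn_integral_add nn_integral_cmult)
    finally have "ennreal (\<delta> * c') * emeasure ?K A' + (R q + ennreal ((b + h) * t\<^sup>2 / (16 * w)))
        \<le> ennreal (\<delta> * c') * emeasure ?K A' + R y"
      unfolding eq by (simp add: add_ac)
    moreover have "ennreal (\<delta> * c') * emeasure ?K A' \<noteq> top"
      by (simp add: ennreal_mult_eq_top_iff)
    ultimately show ?thesis by (simp add: ennreal_add_left_cancel_le)
  qed
  \<comment> \<open>The first-order condition of the newsvendor problem:
    \<open>h * \<rho> = b * (1 - \<rho>)\<close>.\<close>
  have bal: "ennreal (\<delta> * h) * emeasure ?K {..q} = ennreal (\<delta> * b) * emeasure ?K (- {..q})" if "0 \<le> \<delta>" for \<delta>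
    unfolding below above using bh that by (simp flip: ennreal_mult add: mult_ac)
  from y consider "q + t \<le> y" | "y \<le> q - t" by linarith
  then show ?thesis
  proof cases
    case 1
    show ?thesis
      unfolding R_def[symmetric]
      by (rule key[OF loss_gap_right[OF bh t(1) 1]]) (use 1 t bh bal[of "y - q"] in auto)
  next
    case 2
    show ?thesis
      unfolding R_def[symmetric]
      by (rule key[OF loss_gap_left[OF bh t(1) 2]]) (use 2 t bh bal[of "q - y"] in auto)
  qed
qed

corollary tilted_risk_minimal:
  assumes "0 < b" "0 < h" "tilted_cdf w \<theta> q = b / (b + h)" and q: "0 < q" "q < w"
  shows "(\<integral>\<^sup>+d. ennreal (loss b h d q) \<partial>tilted w \<theta>) \<le> (\<integral>\<^sup>+d. ennreal (loss b h d y) \<partial>tilted w \<theta>)"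
proof (cases "y = q")
  case False
  \<comment> \<open>The distance from q, shortened so that the windows fit into
    \<open>[0, w]\<close>; for minimality any positive value serves.\<close>
  define t where "t = min \<bar>y - q\<bar> (min q (w - q))"
  have t: "0 < t" "t \<le> q" "q + t \<le> w" "t \<le> \<bar>y - q\<bar>" using False q by (auto simp: t_def min_def)
  show ?thesis
    by (rule order_trans[OF _ tilted_excess_risk[OF assms(1-3) t]]) simp
qed simp

lemma tilted_risk_le:
  assumes "0 \<le> b" "0 \<le> h" "0 \<le> q" "q \<le> w"
  shows "(\<integral>\<^sup>+d. ennreal (loss b h d q) \<partial>tilted w \<theta>) \<le> ennreal ((b + h) * w)"
proof -
  have "(\<integral>\<^sup>+d. ennreal (loss b h d q) \<partial>tilted w \<theta>)
      = (\<integral>\<^sup>+d. ennreal (tilted_density w \<theta> d) * ennreal (loss b h d q) \<partial>lborel)"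
    unfolding tilted_def by (subst nn_integral_density) auto
  also have "\<dots> \<le> (\<integral>\<^sup>+d. ennreal (tilted_density w \<theta> d) * ennreal ((b + h) * w) \<partial>lborel)"
  proof (rule nn_integral_mono)
    fix d
    show "ennreal (tilted_density w \<theta> d) * ennreal (loss b h d q) \<le> ennreal (tilted_density w \<theta> d) * ennreal ((b + h) * w)"
    proof (cases "d \<in> {0..w}")
      case True
      then have "loss b h d q \<le> b * w + h * w"
        unfolding loss_def using assms w by (intro add_mono mult_left_mono) auto
      then show ?thesis by (intro mult_left_mono ennreal_leI) (auto simp: algebra_simps)
    qed (simp add: tilted_density_def)
  qed
  also have "\<dots> = (\<integral>\<^sup>+d. ennreal ((b + h) * w) \<partial>tilted w \<theta>)"
    unfolding tilted_def by (subst nn_integral_density) auto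
  also have "\<dots> = ennreal ((b + h) * w)" using emeasure_space_1 by simp
  finally show ?thesis .
qed

end

section \<open>Joint laws\<close>

lemma unit_cube_eq_cbox: "unit_cube = cbox 0 (1 :: real^'p::finite)"
  by (auto simp: unit_cube_def mem_box_cart)

lemma unit_cube_measurable [measurable]: "(unit_cube :: (real^'p::finite) set) \<in> sets borel"
  by (simp add: unit_cube_eq_cbox)

lemma emeasure_cbox_cart:
  fixes a b :: "real^'p::finite"
  assumes "\<And>i. a $ i \<le> b $ i"
  shows "emeasure lborel (cbox a b) = ennreal (\<Prod>i\<in>UNIV. b $ i - a $ i)"
proof -
  have "cbox a b \<noteq> {}" using assms by (simp add: interval_ne_empty_cart)
  then have "measure lborel (cbox a b) = (\<Prod>i\<in>UNIV. b $ i - a $ i)" by (rule content_cbox_cart)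
  then show ?thesis
    using emeasure_lborel_cbox_finite[of a b] by (simp add: emeasure_eq_ennreal_measure less_top)
qed

lemma emeasure_unit_cube: "emeasure lborel (unit_cube :: (real^'p::finite) set) = 1"
  unfolding unit_cube_eq_cbox by (subst emeasure_cbox_cart) auto

definition joint :: "real \<Rightarrow> (real^'p::finite \<Rightarrow> real) \<Rightarrow> ((real^'p) \<times> real) measure" where
  "joint w \<theta> = density lborel (\<lambda>(x, d). indicator unit_cube x * ennreal (tilted_density w (\<theta> x) d))"

lemma sets_joint [simp, measurable_cong]: "sets (joint w \<theta>) = sets borel"
  and space_joint [simp]: "space (joint w \<theta>) = UNIV"
  by (simp_all add: joint_def)

text \<open>Laws of observations live on the Borel sets of a product space, while measurability of
  functions of pairs is derived for product sigma-algebras; the two agree by second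
  countability.\<close>

lemma borel_pair_cong [measurable_cong]:
  "sets (borel :: ('a::second_countable_topology \<times> 'b::second_countable_topology) measure) = sets (borel \<Otimes>\<^sub>M borel)"
  by (subst borel_prod) (rule refl)

locale tilted_model =
  fixes w :: real and \<theta> :: "real^'p::finite \<Rightarrow> real"
  assumes w: "0 < w" and \<theta>: "\<And>x. \<bar>\<theta> x\<bar> \<le> 1 / 2"
    and \<theta>_measurable [measurable]: "\<theta> \<in> borel_measurable borel"
begin

sublocale tilt w "\<theta> x" for x
  by unfold_locales (fact w, fact \<theta>)

lemma nn_integral_joint:
  assumes [measurable]: "F \<in> borel_measurable borel"
  shows "(\<integral>\<^sup>+z. F z \<partial>joint w \<theta>) = (\<integral>\<^sup>+x. indicator unit_cube x * (\<integral>\<^sup>+d. F (x, d) \<partial>tilted w (\<theta> x)) \<partial>lborel)"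
proof -
  have "(\<integral>\<^sup>+z. F z \<partial>joint w \<theta>) =
      (\<integral>\<^sup>+z. (case z of (x, d) \<Rightarrow> indicator unit_cube x * ennreal (tilted_density w (\<theta> x) d)) * F z \<partial>(lborel \<Otimes>\<^sub>M lborel))"
    unfolding joint_def lborel_prod[symmetric] by (subst nn_integral_density) auto
  also have "\<dots> = (\<integral>\<^sup>+x. (\<integral>\<^sup>+d. indicator unit_cube x * (ennreal (tilted_density w (\<theta> x) d) * F (x, d)) \<partial>lborel) \<partial>lborel)"
    by (subst lborel.nn_integral_fst[symmetric]) (auto simp: mult.assoc)
  also have "\<dots> = (\<integral>\<^sup>+x. indicator unit_cube x * (\<integral>\<^sup>+d. F (x, d) \<partial>tilted w (\<theta> x)) \<partial>lborel)"
    unfolding tilted_def by (intro nn_integral_cong) (simp add: nn_integral_cmult nn_integral_density)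
  finally show ?thesis .
qed

lemma emeasure_joint_Times:
  assumes [measurable]: "A \<in> sets borel" "B \<in> sets borel"
  shows "emeasure (joint w \<theta>) (A \<times> B) =
    (\<integral>\<^sup>+x. indicator unit_cube x * (emeasure (tilted w (\<theta> x)) B * indicator A x) \<partial>lborel)"
proof -
  have AB: "A \<times> B \<in> sets borel"
    unfolding borel_prod[symmetric] by measurable
  then have "emeasure (joint w \<theta>) (A \<times> B) = (\<integral>\<^sup>+z. indicator (A \<times> B) z \<partial>joint w \<theta>)"
    by simp
  also have "\<dots> = (\<integral>\<^sup>+x. indicator unit_cube x * (\<integral>\<^sup>+d. indicator (A \<times> B) (x, d) \<partial>tilted w (\<theta> x)) \<partial>lborel)"
    by (rule nn_integral_joint) (use AB in measurable)
  also have "\<dots> = (\<integral>\<^sup>+x. indicator unit_cube x * (emeasure (tilted w (\<theta> x)) B * indicator A x) \<partial>lborel)"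
    by (intro nn_integral_cong arg_cong2[of _ _ _ _ "(*)"] refl)
      (simp add: indicator_times nn_integral_cmult mult.commute[of _ "indicator A _"])
  finally show ?thesis .
qed

lemma emeasure_tilted_UNIV: "emeasure (tilted w (\<theta> x)) UNIV = 1"
  using prob_space.emeasure_space_1[OF prob_space_tilted, of x] by simp

lemma prob_space_joint: "prob_space (joint w \<theta>)"
proof
  show "emeasure (joint w \<theta>) (space (joint w \<theta>)) = 1"
    using emeasure_joint_Times[of UNIV UNIV]
    by (simp add: emeasure_tilted_UNIV emeasure_unit_cube)
qed

lemma distr_joint_fst: "distr (joint w \<theta>) borel fst = density lborel (indicator unit_cube)"
proof (rule measure_eqI)
  fix A assume "A \<in> sets (distr (joint w \<theta>) borel fst)"
  then have A [measurable]: "A \<in> sets borel" by simp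
  have "emeasure (distr (joint w \<theta>) borel fst) A = emeasure (joint w \<theta>) (A \<times> UNIV)"
    by (subst emeasure_distr) (auto simp: vimage_fst)
  also have "\<dots> = emeasure (density lborel (indicator unit_cube)) A"
    by (subst emeasure_density) (auto simp: emeasure_joint_Times emeasure_tilted_UNIV)
  finally show "emeasure (distr (joint w \<theta>) borel fst) A = \<dots>" .
qed simp

lemma tilted_kernel: "(\<lambda>x. tilted w (\<theta> x)) \<in> borel \<rightarrow>\<^sub>M prob_algebra borel"
proof (intro measurable_prob_algebraI measurable_subprob_algebra)
  show "subprob_space (tilted w (\<theta> x))" for x by unfold_locales
  fix B :: "real set" assume [measurable]: "B \<in> sets borel"
  show "(\<lambda>x. emeasure (tilted w (\<theta> x)) B) \<in> borel_measurable borel"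
    unfolding tilted_def by (subst emeasure_density) auto
qed (simp_all add: prob_space_tilted)

lemma cond_distribution_joint: "cond_distribution (joint w \<theta>) (\<lambda>x. tilted w (\<theta> x))"
  unfolding cond_distribution_def
proof (intro conjI tilted_kernel ballI)
  fix A :: "(real^'p) set" and B :: "real set"
  assume [measurable]: "A \<in> sets borel" "B \<in> sets borel"
  have [measurable]: "(\<lambda>x. emeasure (tilted w (\<theta> x)) B) \<in> borel_measurable borel"
    unfolding tilted_def by (subst emeasure_density) auto
  show "emeasure (joint w \<theta>) (A \<times> B) =
      (\<integral>\<^sup>+x. emeasure (tilted w (\<theta> x)) B * indicator A x \<partial>distr (joint w \<theta>) borel fst)"
    unfolding distr_joint_fst by (subst nn_integral_density) (auto simp: emeasure_joint_Times)
qed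

lemma msupport_joint_fst: "msupport (distr (joint w \<theta>) borel fst) = unit_cube"
proof (intro equalityI subsetI)
  fix x :: "real^'p" assume x: "x \<in> msupport (distr (joint w \<theta>) borel fst)"
  show "x \<in> unit_cube"
  proof (rule ccontr)
    assume "x \<notin> unit_cube"
    moreover have "open (- (unit_cube :: (real^'p) set))" by (simp add: unit_cube_eq_cbox open_Compl closed_cbox)
    ultimately have "0 < emeasure (distr (joint w \<theta>) borel fst) (- unit_cube)"
      using x unfolding msupport_def by blast
    moreover have "emeasure (distr (joint w \<theta>) borel fst) (- unit_cube) = 0"
      unfolding distr_joint_fst
      by (subst emeasure_density) (auto intro!: nn_integral_zero' AE_I2 split: split_indicator)
    ultimately show False by simp
  qed
next
  fix x :: "real^'p" assume x: "x \<in> unit_cube"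
  show "x \<in> msupport (distr (joint w \<theta>) borel fst)"
    unfolding msupport_def
  proof (intro CollectI allI impI)
    fix U assume U: "open U" "x \<in> U"
    \<comment> \<open>A neighbourhood of a boundary point may barely meet the cube, but the open
      cube is dense in it, so the intersection contains a nonempty open set.\<close>
    have "box 0 (1 :: real^'p) \<noteq> {}" by (simp add: interval_ne_empty_cart)
    then have "closure (box 0 (1 :: real^'p)) = unit_cube" by (simp add: unit_cube_eq_cbox closure_box)
    with x U have "U \<inter> box 0 1 \<noteq> {}" by (metis disjoint_iff open_Int_closure_eq_empty)
    then have "\<not> negligible (U \<inter> box 0 1)" using U by (intro open_not_negligible) auto
    then have pos: "0 < emeasure lborel (U \<inter> box 0 1)"
      using U by (auto simp: negligible_iff_emeasure0 zero_less_iff_neq_zero)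
    have "emeasure lborel (U \<inter> box 0 1) \<le> emeasure lborel (unit_cube \<inter> U)"
      using U box_subset_cbox[of 0 "1 :: real^'p"] by (intro emeasure_mono) (auto simp: unit_cube_eq_cbox)
    also have "\<dots> = emeasure (distr (joint w \<theta>) borel fst) U"
      unfolding distr_joint_fst using U by (subst emeasure_density) (auto simp flip: indicator_inter_arith)
    finally show "0 < emeasure (distr (joint w \<theta>) borel fst) U" using pos by simp
  qed
qed

lemma msupport_joint_snd: "msupport (distr (joint w \<theta>) borel snd) \<subseteq> {0..w}"
proof (rule ccontr)
  assume "\<not> msupport (distr (joint w \<theta>) borel snd) \<subseteq> {0..w}"
  then obtain d where d: "d \<in> msupport (distr (joint w \<theta>) borel snd)" "d \<in> - {0..w}" by blast
  have "open (- {0..w})" by (intro open_Compl) simp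
  with d have pos: "0 < emeasure (distr (joint w \<theta>) borel snd) (- {0..w})" unfolding msupport_def by blast
  have "emeasure (distr (joint w \<theta>) borel snd) (- {0..w}) = emeasure (joint w \<theta>) (UNIV \<times> - {0..w})"
    by (subst emeasure_distr) (auto simp: vimage_snd)
  also have "\<dots> = 0" by (subst emeasure_joint_Times) (auto simp: emeasure_tilted_outside)
  finally show False using pos by simp
qed

lemma risk_joint:
  assumes [measurable]: "f \<in> borel_measurable borel"
  shows "risk b h (joint w \<theta>) f =
    (\<integral>\<^sup>+x. indicator unit_cube x * (\<integral>\<^sup>+d. ennreal (loss b h d (f x)) \<partial>tilted w (\<theta> x)) \<partial>lborel)"
  unfolding risk_def by (subst nn_integral_joint) (auto simp: loss_def)

text \<open>Solving \<open>u + \<theta> u (1 - u) = \<rho>\<close> for \<open>\<theta>\<close> shows which tilt puts the \<open>\<rho>\<close>-quantile at \<open>w u\<close>.\<close>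

lemma cond_quantile_joint:
  assumes u: "0 < u x" "u x < 1" and tilt: "\<theta> x = (\<rho> - u x) / (u x * (1 - u x))"
  shows "tilted_cdf w (\<theta> x) (w * u x) = \<rho>" "cond_quantile (\<lambda>x. tilted w (\<theta> x)) \<rho> x = w * u x"
proof -
  show cdf: "tilted_cdf w (\<theta> x) (w * u x) = \<rho>"
    unfolding tilted_cdf_def tilt using u w by (simp add: field_simps)
  show "cond_quantile (\<lambda>x. tilted w (\<theta> x)) \<rho> x = w * u x"
    unfolding cond_quantile_def using quantile_tilted[of "w * u x" x] u w
    unfolding cdf by (simp add: mult_le_cancel_left1)
qed

lemma joint_in_newsvendor_class:
  assumes "w \<le> Dbar" "\<kappa> \<le> 1 / (2 * w)"
    and "cond_quantile (\<lambda>x. tilted w (\<theta> x)) \<rho> \<in> holder_class \<beta> unit_cube B"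
  shows "(joint w \<theta>, \<lambda>x. tilted w (\<theta> x)) \<in> newsvendor_class \<rho> \<beta> B Dbar \<kappa>"
  unfolding newsvendor_class_def
proof (intro CollectI case_prodI conjI)
  show "prob_space (joint w \<theta>)" by (rule prob_space_joint)
  show "cond_distribution (joint w \<theta>) (\<lambda>x. tilted w (\<theta> x))" by (rule cond_distribution_joint)
  show "msupport (distr (joint w \<theta>) borel snd) \<subseteq> {0..Dbar}"
    using msupport_joint_snd assms(1) by fastforce
  show "msupport (distr (joint w \<theta>) borel fst) = unit_cube" by (rule msupport_joint_fst)
  show "absolutely_continuous lborel (distr (joint w \<theta>) borel fst)"
    unfolding distr_joint_fst by (rule absolutely_continuousI_density) simp
  show "\<exists>g L. \<forall>x\<in>unit_cube. distributed (tilted w (\<theta> x)) lborel (\<lambda>d. d) (\<lambda>d. ennreal (g x d)) \<and>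
      L-lipschitz_on (msupport (tilted w (\<theta> x))) (g x) \<and> (\<forall>d\<in>msupport (tilted w (\<theta> x)). \<kappa> \<le> g x d)"
  proof (intro exI ballI conjI)
    fix x
    show "distributed (tilted w (\<theta> x)) lborel (\<lambda>d. d) (\<lambda>d. ennreal (tilted_density w (\<theta> x) d))"
      by (rule distributed_tilted)
    show "(1 / w\<^sup>2)-lipschitz_on (msupport (tilted w (\<theta> x))) (tilted_density w (\<theta> x))"
    proof (rule lipschitz_on_subset[OF _ msupport_tilted], rule lipschitz_onI)
      fix d e assume de: "d \<in> {0..w}" "e \<in> {0..w}"
      \<comment> \<open>On \<open>[0, w]\<close> the density is affine; its slope has modulus
        \<open>2 * \<bar>\<theta> x\<bar>\<close> over the square of w, and the tilt is at most
        1/2.\<close>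
      have "tilted_density w (\<theta> x) d - tilted_density w (\<theta> x) e = 2 * \<theta> x / w\<^sup>2 * (e - d)"
        using de w by (simp add: tilted_density_def field_simps power2_eq_square)
      then have "\<bar>tilted_density w (\<theta> x) d - tilted_density w (\<theta> x) e\<bar> = 2 * \<bar>\<theta> x\<bar> / w\<^sup>2 * \<bar>d - e\<bar>"
        by (simp add: abs_mult abs_minus_commute)
      also have "\<dots> \<le> 1 / w\<^sup>2 * \<bar>d - e\<bar>"
        using \<theta>[of x] w by (intro mult_right_mono divide_right_mono) auto
      finally show "dist (tilted_density w (\<theta> x) d) (tilted_density w (\<theta> x) e) \<le> 1 / w\<^sup>2 * dist d e"
        by (simp add: dist_real_def)
    qed (simp add: w)
    fix d assume "d \<in> msupport (tilted w (\<theta> x))"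
    then have "d \<in> {0..w}" using msupport_tilted by blast
    then show "\<kappa> \<le> tilted_density w (\<theta> x) d"
      using tilted_density_ge[of d x] assms(2) by simp
  qed
  show "\<exists>u M. distributed (joint w \<theta>) lborel fst (\<lambda>x. ennreal (u x)) \<and> (\<forall>x\<in>unit_cube. u x \<le> M)"
  proof (intro exI conjI ballI)
    have "distr (joint w \<theta>) lborel fst = distr (joint w \<theta>) borel fst"
      by (rule distr_cong) auto
    then show "distributed (joint w \<theta>) lborel fst (\<lambda>x. ennreal (indicator unit_cube x))"
      unfolding distributed_def by (simp add: distr_joint_fst ennreal_indicator)
    show "indicator unit_cube x \<le> (1 :: real)" for x :: "real^'p" by (simp add: indicator_def)
  qed
qed (use assms in simp_all)

end

section \<open>Testing two laws from a sample\<close>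

text \<open>Turns an expectation over a sample from the second law into one over a sample from the
  first, weighted by the likelihood ratio.\<close>

lemma PiM_density:
  assumes "prob_space P" "prob_space (density P f)" "finite I" and [measurable]: "f \<in> borel_measurable P"
  shows "(\<Pi>\<^sub>M i\<in>I. density P f) = density (\<Pi>\<^sub>M i\<in>I. P) (\<lambda>S. \<Prod>i\<in>I. f (S i))"
proof -
  interpret P: prob_space P by fact
  interpret Q: prob_space "density P f" by fact
  interpret PP: product_sigma_finite "\<lambda>_. P" by unfold_locales
  interpret QQ: product_sigma_finite "\<lambda>_. density P f" by unfold_locales
  have prod_measurable [measurable]: "(\<lambda>S. \<Prod>i\<in>I. f (S i)) \<in> borel_measurable (\<Pi>\<^sub>M i\<in>I. P)"
    by measurable
  show ?thesis
  proof (rule QQ.PiM_eqI[symmetric])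
    show "sets (density (\<Pi>\<^sub>M i\<in>I. P) (\<lambda>S. \<Prod>i\<in>I. f (S i))) = sets (\<Pi>\<^sub>M i\<in>I. density P f)"
      by (auto intro!: sets_PiM_cong)
    fix A assume "\<And>i. i \<in> I \<Longrightarrow> A i \<in> sets (density P f)"
    then have A [measurable]: "\<And>i. i \<in> I \<Longrightarrow> A i \<in> sets P" by simp
    have "Pi\<^sub>E I A \<in> sets (\<Pi>\<^sub>M i\<in>I. P)" using A \<open>finite I\<close> by (intro sets_PiM_I_finite)
    then have "emeasure (density (\<Pi>\<^sub>M i\<in>I. P) (\<lambda>S. \<Prod>i\<in>I. f (S i))) (Pi\<^sub>E I A)
        = (\<integral>\<^sup>+S. (\<Prod>i\<in>I. f (S i)) * indicator (Pi\<^sub>E I A) S \<partial>(\<Pi>\<^sub>M i\<in>I. P))"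
      by (subst emeasure_density) auto
    also have "\<dots> = (\<integral>\<^sup>+S. (\<Prod>i\<in>I. f (S i) * indicator (A i) (S i)) \<partial>(\<Pi>\<^sub>M i\<in>I. P))"
    proof (rule nn_integral_cong)
      fix S assume "S \<in> space (\<Pi>\<^sub>M i\<in>I. P)"
      then have "S \<in> extensional I" by (simp add: space_PiM PiE_def)
      then have "indicator (Pi\<^sub>E I A) S = (\<Prod>i\<in>I. indicator (A i) (S i) :: ennreal)"
        using \<open>finite I\<close> by (auto simp: PiE_def Pi_def indicator_def prod_zero_iff)
      then show "(\<Prod>i\<in>I. f (S i)) * indicator (Pi\<^sub>E I A) S = (\<Prod>i\<in>I. f (S i) * indicator (A i) (S i))"
        by (simp add: prod.distrib)
    qed
    also have "\<dots> = (\<Prod>i\<in>I. \<integral>\<^sup>+x. f x * indicator (A i) x \<partial>P)"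
      by (rule PP.product_nn_integral_prod[OF \<open>finite I\<close>, where f = "\<lambda>i x. f x * indicator (A i) x"]) measurable
    also have "\<dots> = (\<Prod>i\<in>I. emeasure (density P f) (A i))"
      by (intro prod.cong refl) (simp add: emeasure_density)
    finally show "emeasure (density (\<Pi>\<^sub>M i\<in>I. P) (\<lambda>S. \<Prod>i\<in>I. f (S i))) (Pi\<^sub>E I A) = \<dots>" .
  qed (fact \<open>finite I\<close>)
qed

lemma power_one_plus_le:
  fixes \<epsilon> :: real
  assumes "0 \<le> \<epsilon>" "real n * \<epsilon> \<le> 1 / 4"
  shows "(1 + \<epsilon>) ^ n \<le> 3 / 2"
proof -
  have "(1 + \<epsilon>) ^ n \<le> exp \<epsilon> ^ n" using assms by (intro power_mono) auto
  also have "\<dots> = exp (real n * \<epsilon>)" by (simp add: exp_of_nat_mult)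
  also have "\<dots> \<le> exp (1 / 4)" using assms by simp
  also have "\<dots> \<le> 1 + 1 / 4 + (1 / 4)\<^sup>2" by (rule exp_bound) auto
  also have "\<dots> \<le> 3 / 2" by (simp add: power2_eq_square)
  finally show ?thesis .
qed

text \<open>The affinity \<open>E min 1 L\<close> of the two product laws is bounded below by integrating
  \<open>L \<le> min 1 L + L\<^sup>2 / 2\<close>, where \<open>L\<close> is the likelihood ratio.\<close>

lemma two_point_bound:
  fixes l :: "'a \<Rightarrow> real" and A B :: "(nat \<Rightarrow> 'a) \<Rightarrow> ennreal"
  assumes P: "prob_space P" and Q: "prob_space (density P (\<lambda>z. ennreal (l z)))"
    and l [measurable]: "l \<in> borel_measurable P" and l_nonneg: "\<And>z. 0 \<le> l z"
    and chi: "(\<integral>\<^sup>+z. ennreal ((l z - 1)\<^sup>2) \<partial>P) \<le> ennreal \<epsilon>" and \<epsilon>: "0 \<le> \<epsilon>" "real n * \<epsilon> \<le> 1 / 4"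
    and A [measurable]: "A \<in> borel_measurable (\<Pi>\<^sub>M i\<in>{..<n}. P)"
    and B [measurable]: "B \<in> borel_measurable (\<Pi>\<^sub>M i\<in>{..<n}. P)"
    and AB: "\<And>S. S \<in> space (\<Pi>\<^sub>M i\<in>{..<n}. P) \<Longrightarrow> v \<le> A S + B S"
  shows "v / 4 \<le> (\<integral>\<^sup>+S. A S \<partial>(\<Pi>\<^sub>M i\<in>{..<n}. P)) + (\<integral>\<^sup>+S. B S \<partial>(\<Pi>\<^sub>M i\<in>{..<n}. density P (\<lambda>z. ennreal (l z))))"
proof -
  interpret P: prob_space P by fact
  interpret PP: product_sigma_finite "\<lambda>_. P" by unfold_locales
  interpret Pn: prob_space "\<Pi>\<^sub>M i\<in>{..<n}. P" by (intro prob_space_PiM P)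
  define L where "L S = (\<Prod>i<n. ennreal (l (S i)))" for S
  have L [measurable]: "L \<in> borel_measurable (\<Pi>\<^sub>M i\<in>{..<n}. P)" unfolding L_def by measurable
  have l1: "(\<integral>\<^sup>+z. ennreal (l z) \<partial>P) = 1"
  proof -
    have "(\<integral>\<^sup>+z. ennreal (l z) \<partial>P) = (\<integral>\<^sup>+z. ennreal (l z) * indicator (space P) z \<partial>P)"
      by (intro nn_integral_cong) simp
    also have "\<dots> = emeasure (density P (\<lambda>z. ennreal (l z))) (space P)"
      by (rule emeasure_density[symmetric]) auto
    also have "\<dots> = 1" using prob_space.emeasure_space_1[OF Q] by simp
    finally show ?thesis .
  qed
  have L1: "(\<integral>\<^sup>+S. L S \<partial>(\<Pi>\<^sub>M i\<in>{..<n}. P)) = 1"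
    unfolding L_def by (subst PP.product_nn_integral_prod) (auto simp: l1)
  \<comment> \<open>The second moment of the likelihood ratio is one plus the chi-square distance.
    The identity \<open>l^2 + 1 = 2 * l + (l - 1)^2\<close> expresses this with sums only.\<close>
  have l2: "(\<integral>\<^sup>+z. ennreal (l z) ^ 2 \<partial>P) \<le> ennreal (1 + \<epsilon>)"
  proof -
    have "(\<integral>\<^sup>+z. ennreal (l z) ^ 2 \<partial>P) + 1 = (\<integral>\<^sup>+z. ennreal (l z) ^ 2 + 1 \<partial>P)"
      by (subst nn_integral_add) (auto simp: P.emeasure_space_1)
    also have "\<dots> = (\<integral>\<^sup>+z. 2 * ennreal (l z) + ennreal ((l z - 1)\<^sup>2) \<partial>P)"
    proof (rule nn_integral_cong)
      fix z
      have "ennreal (l z) ^ 2 + 1 = ennreal ((l z)\<^sup>2 + 1)"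
        using l_nonneg by (simp add: ennreal_power)
      also have "(l z)\<^sup>2 + 1 = 2 * l z + (l z - 1)\<^sup>2" by (simp add: power2_eq_square algebra_simps)
      also have "ennreal \<dots> = 2 * ennreal (l z) + ennreal ((l z - 1)\<^sup>2)"
        using l_nonneg by (subst ennreal_plus) (auto simp: ennreal_mult)
      finally show "ennreal (l z) ^ 2 + 1 = \<dots>" .
    qed
    also have "\<dots> = 2 + (\<integral>\<^sup>+z. ennreal ((l z - 1)\<^sup>2) \<partial>P)"
      by (subst nn_integral_add) (auto simp: nn_integral_cmult l1)
    also have "\<dots> \<le> 2 + ennreal \<epsilon>" using chi by (rule add_left_mono)
    also have "\<dots> = 1 + ennreal (1 + \<epsilon>)" using \<epsilon> by (simp add: add.assoc[symmetric])
    finally show ?thesis by (simp add: add.commute[of _ 1] ennreal_add_left_cancel_le)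
  qed
  have L2: "(\<integral>\<^sup>+S. L S ^ 2 \<partial>(\<Pi>\<^sub>M i\<in>{..<n}. P)) \<le> ennreal (3 / 2)"
  proof -
    have "(\<integral>\<^sup>+S. L S ^ 2 \<partial>(\<Pi>\<^sub>M i\<in>{..<n}. P)) = (\<Prod>i<n. \<integral>\<^sup>+z. ennreal (l z) ^ 2 \<partial>P)"
      unfolding L_def prod_power_distrib by (subst PP.product_nn_integral_prod) auto
    also have "\<dots> \<le> (\<Prod>i<n. ennreal (1 + \<epsilon>))" using l2 by (intro prod_mono_ennreal)
    also have "\<dots> = ennreal ((1 + \<epsilon>) ^ n)" using \<epsilon> by (simp add: ennreal_power del: ennreal_plus)
    also have "\<dots> \<le> ennreal (3 / 2)" using power_one_plus_le[OF \<epsilon>] by (rule ennreal_leI)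
    finally show ?thesis .
  qed
  \<comment> \<open>For x at least one this is weaker than \<open>2 * x \<le> 1 + x ^ 2\<close>;
    below one the minimum is x itself.\<close>
  have min_ge: "x \<le> min 1 x + x ^ 2 / 2" for x :: ennreal
  proof (cases "1 \<le> x")
    case True
    show ?thesis
    proof (cases x)
      case (real r)
      have "0 \<le> (r - 1)\<^sup>2" by simp
      then have "r \<le> 1 + r\<^sup>2 / 2" by (simp add: power2_eq_square algebra_simps)
      then have "ennreal r \<le> ennreal (1 + r\<^sup>2 / 2)" by (rule ennreal_leI)
      also have "\<dots> = min 1 x + x ^ 2 / 2"
        using True real by (simp add: min_absorb1 ennreal_power ennreal_divide_numeral)
      finally show ?thesis using real by simp
    next
      case top
      then show ?thesis by (simp add: ennreal_top_divide power2_eq_square ennreal_top_mult)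
    qed
  qed (simp add: min_absorb2)
  have "(\<integral>\<^sup>+S. L S \<partial>(\<Pi>\<^sub>M i\<in>{..<n}. P)) \<le> (\<integral>\<^sup>+S. min 1 (L S) + L S ^ 2 / 2 \<partial>(\<Pi>\<^sub>M i\<in>{..<n}. P))"
    by (intro nn_integral_mono min_ge)
  also have "\<dots> = (\<integral>\<^sup>+S. min 1 (L S) \<partial>(\<Pi>\<^sub>M i\<in>{..<n}. P)) + (\<integral>\<^sup>+S. L S ^ 2 \<partial>(\<Pi>\<^sub>M i\<in>{..<n}. P)) / 2"
    by (subst nn_integral_add) (auto simp: nn_integral_divide)
  also have "\<dots> \<le> (\<integral>\<^sup>+S. min 1 (L S) \<partial>(\<Pi>\<^sub>M i\<in>{..<n}. P)) + ennreal (3 / 2) / 2"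
    by (intro add_left_mono divide_right_mono_ennreal L2)
  also have "ennreal (3 / 2) / 2 = ennreal (3 / 4)" by (simp add: ennreal_divide_numeral)
  finally have "1 \<le> (\<integral>\<^sup>+S. min 1 (L S) \<partial>(\<Pi>\<^sub>M i\<in>{..<n}. P)) + ennreal (3 / 4)"
    unfolding L1 .
  \<comment> \<open>The second moment over the sample is at most 3/2, so the quadratic term takes at
    most 3/4 and the affinity is at least 1/4.\<close>
  moreover have "ennreal (1 / 4) + ennreal (3 / 4) = 1"
    by (subst ennreal_plus[symmetric]) auto
  ultimately have "ennreal (1 / 4) + ennreal (3 / 4) \<le> (\<integral>\<^sup>+S. min 1 (L S) \<partial>(\<Pi>\<^sub>M i\<in>{..<n}. P)) + ennreal (3 / 4)"
    by simp
  then have min14: "ennreal (1 / 4) \<le> (\<integral>\<^sup>+S. min 1 (L S) \<partial>(\<Pi>\<^sub>M i\<in>{..<n}. P))"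
    by (simp add: add.commute[of _ "ennreal (3 / 4)"] ennreal_add_left_cancel_le)
  have "v / 4 = ennreal (1 / 4) * v"
    by (simp add: divide_ennreal_def ennreal_divide_numeral[symmetric] inverse_ennreal mult.commute)
  also have "\<dots> \<le> (\<integral>\<^sup>+S. min 1 (L S) \<partial>(\<Pi>\<^sub>M i\<in>{..<n}. P)) * v"
    using min14 by (rule mult_right_mono) simp
  also have "\<dots> = (\<integral>\<^sup>+S. min 1 (L S) * v \<partial>(\<Pi>\<^sub>M i\<in>{..<n}. P))"
    by (simp add: nn_integral_multc)
  also have "\<dots> \<le> (\<integral>\<^sup>+S. A S + L S * B S \<partial>(\<Pi>\<^sub>M i\<in>{..<n}. P))"
  proof (rule nn_integral_mono)
    fix S assume "S \<in> space (\<Pi>\<^sub>M i\<in>{..<n}. P)"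
    then have "min 1 (L S) * v \<le> min 1 (L S) * A S + min 1 (L S) * B S"
      using AB by (simp add: mult_left_mono flip: distrib_left)
    \<comment> \<open>The minimum is bounded by 1 in front of A and by the likelihood ratio in front
      of B, which changes the law for B.\<close>
    also have "\<dots> \<le> 1 * A S + L S * B S" by (intro add_mono mult_right_mono) auto
    finally show "min 1 (L S) * v \<le> A S + L S * B S" by simp
  qed
  also have "\<dots> = (\<integral>\<^sup>+S. A S \<partial>(\<Pi>\<^sub>M i\<in>{..<n}. P)) + (\<integral>\<^sup>+S. L S * B S \<partial>(\<Pi>\<^sub>M i\<in>{..<n}. P))"
    by (rule nn_integral_add) auto
  also have "(\<integral>\<^sup>+S. L S * B S \<partial>(\<Pi>\<^sub>M i\<in>{..<n}. P))
      = (\<integral>\<^sup>+S. B S \<partial>(\<Pi>\<^sub>M i\<in>{..<n}. density P (\<lambda>z. ennreal (l z))))"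
    by (subst PiM_density[OF P Q]) (auto simp: nn_integral_density L_def[symmetric])
  finally show ?thesis .
qed

section \<open>Likelihood ratio and chi-square distance between tilted laws\<close>

definition tilt_ratio :: "real \<Rightarrow> ('a \<Rightarrow> real) \<Rightarrow> 'a \<times> real \<Rightarrow> real" where
  "tilt_ratio w \<tau> = (\<lambda>(x, d). 1 + \<tau> x * (indicator {0..w} d * (1 - 2 * d / w)))"

text \<open>The indicator in the ratio makes this hold for every d, also outside the support, so
  nonnegativity needs no exceptional null set.\<close>

lemma tilt_ratio_dev:
  assumes "0 < w"
  shows "\<bar>tilt_ratio w \<tau> (x, d) - 1\<bar> \<le> \<bar>\<tau> x\<bar>"
proof -
  have "\<bar>indicator {0..w} d * (1 - 2 * d / w)\<bar> \<le> 1"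
    using assms by (auto simp: abs_le_iff field_simps split: split_indicator)
  then have "\<bar>\<tau> x\<bar> * \<bar>indicator {0..w} d * (1 - 2 * d / w)\<bar> \<le> \<bar>\<tau> x\<bar> * 1" by (intro mult_left_mono) auto
  then show ?thesis by (simp add: tilt_ratio_def abs_mult)
qed

lemma tilt_ratio_measurable [measurable]:
  fixes \<tau> :: "real^'p::finite \<Rightarrow> real"
  assumes [measurable]: "\<tau> \<in> borel_measurable borel"
  shows "tilt_ratio w \<tau> \<in> borel_measurable borel"
  unfolding tilt_ratio_def by measurable

text \<open>With k denoting \<open>1 - 2 * d / w\<close>, the product
  \<open>(1 + \<theta> * k) * (1 + \<tau> * k)\<close> equals
  \<open>1 + (\<theta> + \<tau>) * k\<close> because one of the two tilts vanishes at each x. The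
  ratio therefore depends on \<tau> alone.\<close>

lemma (in tilted_model) joint_tilt_density:
  fixes \<tau> :: "real^'p \<Rightarrow> real"
  assumes [measurable]: "\<tau> \<in> borel_measurable borel"
    and \<tau>: "\<And>x. \<bar>\<tau> x\<bar> \<le> 1 / 2" and disj: "\<And>x. \<theta> x = 0 \<or> \<tau> x = 0"
  shows "joint w (\<lambda>x. \<theta> x + \<tau> x) = density (joint w \<theta>) (\<lambda>z. ennreal (tilt_ratio w \<tau> z))"
proof -
  have ratio_nonneg: "0 \<le> tilt_ratio w \<tau> (x, d)" for x d
    using tilt_ratio_dev[OF w, of \<tau> x d] \<tau>[of x] by linarith
  have "tilted_density w (\<theta> x + \<tau> x) d = tilted_density w (\<theta> x) d * tilt_ratio w \<tau> (x, d)" for x d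
    using disj[of x] by (auto simp: tilted_density_def tilt_ratio_def split: split_indicator)
  then have "ennreal (tilted_density w (\<theta> x + \<tau> x) d)
      = ennreal (tilted_density w (\<theta> x) d) * ennreal (tilt_ratio w \<tau> (x, d))" for x d
    using ratio_nonneg by (simp add: ennreal_mult tilted_density_nonneg)
  then show ?thesis
    unfolding joint_def by (subst density_density_eq) (auto simp: mult.assoc case_prod_beta intro!: density_cong)
qed

lemma (in tilted_model) chi_square_joint_le:
  fixes \<tau> :: "real^'p \<Rightarrow> real"
  assumes [measurable]: "\<tau> \<in> borel_measurable borel"
  shows "(\<integral>\<^sup>+z. ennreal ((tilt_ratio w \<tau> z - 1)\<^sup>2) \<partial>joint w \<theta>) \<le> (\<integral>\<^sup>+x. indicator unit_cube x * ennreal ((\<tau> x)\<^sup>2) \<partial>lborel)"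
proof -
  have "(\<integral>\<^sup>+z. ennreal ((tilt_ratio w \<tau> z - 1)\<^sup>2) \<partial>joint w \<theta>)
      = (\<integral>\<^sup>+x. indicator unit_cube x * (\<integral>\<^sup>+d. ennreal ((tilt_ratio w \<tau> (x, d) - 1)\<^sup>2) \<partial>tilted w (\<theta> x)) \<partial>lborel)"
    by (rule nn_integral_joint) measurable
  also have "\<dots> \<le> (\<integral>\<^sup>+x. indicator unit_cube x * (\<integral>\<^sup>+d. ennreal ((\<tau> x)\<^sup>2) \<partial>tilted w (\<theta> x)) \<partial>lborel)"
    using tilt_ratio_dev[OF w, of \<tau>]
    by (intro nn_integral_mono mult_left_mono ennreal_leI) (auto simp: abs_le_square_iff)
  finally show ?thesis by (simp add: emeasure_tilted_UNIV)
qed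

section \<open>The hypercube of joint laws\<close>

text \<open>For fixed j, pairing each set without j with the set that also contains j shows that the
  errors at j, summed over all subsets, are at least \<open>2 ^ (card J - 1) * v\<close>. Summing
  over j and exchanging the sums compares this with \<open>2 ^ card J * M\<close>.\<close>

lemma assouad_sum:
  fixes e :: "'j set \<Rightarrow> 'j \<Rightarrow> ennreal"
  assumes J: "finite J"
    and flip: "\<And>j \<omega>. j \<in> J \<Longrightarrow> \<omega> \<subseteq> J - {j} \<Longrightarrow> v \<le> e \<omega> j + e (insert j \<omega>) j"
    and total: "\<And>\<omega>. \<omega> \<subseteq> J \<Longrightarrow> (\<Sum>j\<in>J. e \<omega> j) \<le> M"
  shows "of_nat (card J) * v \<le> 2 * M"
proof (cases "J = {}")
  case False
  define N :: ennreal where "N = of_nat (2 ^ (card J - 1))"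
  have "0 < card J" using False J by (simp add: card_gt_0_iff)
  then have card: "(2::nat) ^ card J = 2 * 2 ^ (card J - 1)" by (metis Suc_diff_1 power_Suc)
  have half: "N * v \<le> (\<Sum>\<omega>\<in>Pow J. e \<omega> j)" if j: "j \<in> J" for j
  proof -
    have fin: "finite (Pow (J - {j}))" using J by simp
    have "card (Pow (J - {j})) = 2 ^ (card J - 1)" using J j by (simp add: card_Pow)
    then have "N * v = (\<Sum>\<omega>\<in>Pow (J - {j}). v)" by (simp add: N_def)
    also have "\<dots> \<le> (\<Sum>\<omega>\<in>Pow (J - {j}). e \<omega> j + e (insert j \<omega>) j)"
      using flip[OF j] by (intro sum_mono) auto
    also have "\<dots> = (\<Sum>\<omega>\<in>Pow (J - {j}). e \<omega> j) + (\<Sum>\<omega>\<in>insert j ` Pow (J - {j}). e \<omega> j)"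
      by (subst sum.reindex) (auto simp: sum.distrib inj_on_def)
    also have "\<dots> = (\<Sum>\<omega>\<in>Pow (J - {j}) \<union> insert j ` Pow (J - {j}). e \<omega> j)"
      using fin by (intro sum.union_disjoint[symmetric]) auto
    also have "Pow (J - {j}) \<union> insert j ` Pow (J - {j}) = Pow J"
      using Pow_insert[of j "J - {j}"] j by (simp add: insert_absorb)
    finally show ?thesis .
  qed
  have "N * (of_nat (card J) * v) = (\<Sum>j\<in>J. N * v)" by (simp add: mult.left_commute)
  also have "\<dots> \<le> (\<Sum>j\<in>J. \<Sum>\<omega>\<in>Pow J. e \<omega> j)" by (intro sum_mono half)
  also have "\<dots> = (\<Sum>\<omega>\<in>Pow J. \<Sum>j\<in>J. e \<omega> j)" by (rule sum.swap)
  also have "\<dots> \<le> (\<Sum>\<omega>\<in>Pow J. M)" using total by (intro sum_mono) auto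
  also have "\<dots> = N * (2 * M)" by (simp add: card_Pow J card N_def mult_ac)
  finally show ?thesis
    by (subst (asm) ennreal_mult_le_mult_iff) (auto simp: N_def of_nat_less_top ennreal_of_nat_eq_real_of_nat)
qed simp

text \<open>The bound on \<epsilon> has two uses: it keeps the level \<rho> plus a bump inside (0,
  1) with a margin of at least \<epsilon> on both sides, and it keeps the resulting tilt at most
  1/2.\<close>

locale hypercube = bump +
  fixes w \<rho> \<epsilon> :: real and m :: nat
  assumes w: "0 < w" and \<rho>: "0 < \<rho>" "\<rho> < 1"
    and \<epsilon>: "0 < \<epsilon>" "\<epsilon> \<le> \<rho> * (1 - \<rho>) / 4" and m: "1 \<le> m"
begin

section \<open>Grid cells, their cores, and levels\<close>

definition cells :: "('p::finite \<Rightarrow> nat) set" where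
  "cells = {j. \<forall>i. j i < m}"

text \<open>The middle half of the cell in each coordinate, where every factor of the bump is at
  least \<eta>.\<close>

definition core :: "('p::finite \<Rightarrow> nat) \<Rightarrow> (real^'p) set" where
  "core j = cbox (\<chi> i. (real (j i) + 1/4) / real m) (\<chi> i. (real (j i) + 3/4) / real m)"

text \<open>The target quantile in units of w.\<close>

definition level :: "('p::finite \<Rightarrow> nat) set \<Rightarrow> real^'p \<Rightarrow> real" where
  "level \<omega> x = \<rho> + \<epsilon> * (\<Sum>j\<in>\<omega>. cell_bump (real m) j (\<lambda>_. 0) x)"

definition level_tilt :: "('p::finite \<Rightarrow> nat) set \<Rightarrow> real^'p \<Rightarrow> real" where
  "level_tilt \<omega> x = (\<rho> - level \<omega> x) / (level \<omega> x * (1 - level \<omega> x))"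

lemma cells_eq: "(cells :: ('p::finite \<Rightarrow> nat) set) = PiE UNIV (\<lambda>_. {..<m})"
  by (auto simp: cells_def PiE_def Pi_def)

lemma finite_cells [simp]: "finite (cells :: ('p::finite \<Rightarrow> nat) set)"
  unfolding cells_eq by (intro finite_PiE) auto

lemma card_cells: "card (cells :: ('p::finite \<Rightarrow> nat) set) = m ^ CARD('p)"
  unfolding cells_eq by (simp add: card_PiE)

lemma mem_core: "x \<in> core j \<longleftrightarrow> (\<forall>i. real m * x $ i - real (j i) \<in> {1/4..3/4})"
  using m by (auto simp: core_def mem_box_cart field_simps)

lemma core_measurable [measurable]: "core j \<in> sets borel"
  by (simp add: core_def)

lemma emeasure_core:
  "emeasure lborel (core j :: (real^'p::finite) set) = ennreal ((1 / (2 * real m)) ^ CARD('p))"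
proof -
  have "(real (j i) + 3/4) / real m - (real (j i) + 1/4) / real m = 1 / (2 * real m)" for i
    using m by (simp add: field_simps)
  then show ?thesis unfolding core_def using m
    by (subst emeasure_cbox_cart) (auto intro!: divide_right_mono)
qed

lemma core_subset_unit_cube: "j \<in> cells \<Longrightarrow> core j \<subseteq> unit_cube"
proof (intro subsetI)
  fix x assume j: "j \<in> cells" and x: "x \<in> core j"
  have "0 \<le> x $ i \<and> x $ i \<le> 1" for i
  proof -
    have "real m * x $ i - real (j i) \<in> {1/4..3/4}" using x mem_core by blast
    moreover have "real (j i) + 1 \<le> real m"
    proof -
      have "Suc (j i) \<le> m" using j by (simp add: cells_def Suc_le_eq)
      then show ?thesis by linarith
    qed
    ultimately have "0 \<le> real m * x $ i" "real m * x $ i \<le> real m * 1" unfolding atLeastAtMost_iff by linarith+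
    then show ?thesis
      using m mult_le_cancel_left_pos[of "real m" "x $ i" 1] by (auto simp: zero_le_mult_iff)
  qed
  then show "x \<in> unit_cube" by (simp add: unit_cube_def)
qed

lemma core_disjoint: "x \<in> core j \<Longrightarrow> x \<in> core j' \<Longrightarrow> j = j'"
proof
  fix i assume "x \<in> core j" "x \<in> core j'"
  then have "real m * x $ i - real (j i) \<in> {1/4..3/4}" "real m * x $ i - real (j' i) \<in> {1/4..3/4}"
    using mem_core by blast+
  then have "real (j i) < real (j' i) + 1" "real (j' i) < real (j i) + 1" by auto
  then show "j i = j' i" by linarith
qed

lemma sum_indicator_core_le:
  "(\<Sum>j\<in>cells. indicator (core j) x) \<le> (indicator unit_cube x :: ennreal)"
proof (cases "\<exists>j\<in>cells. x \<in> core j")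
  case True
  then obtain j where j: "j \<in> cells" "x \<in> core j" by blast
  have "(\<Sum>j\<in>cells. indicator (core j) x :: ennreal) = (\<Sum>j\<in>{j}. indicator (core j) x)"
    by (rule sum.mono_neutral_right) (use j core_disjoint in \<open>auto simp: indicator_def\<close>)
  moreover have "x \<in> unit_cube" using j core_subset_unit_cube by blast
  ultimately show ?thesis using j by simp
next
  case False
  then show ?thesis by simp
qed

lemma cell_bump_nonneg: "0 \<le> cell_bump (real m) j (\<lambda>_. 0) x"
  unfolding cell_bump_def by (intro prod_nonneg) (simp add: \<phi>_nonneg)

lemma cell_bump_core:
  fixes x :: "real^'p::finite"
  assumes "x \<in> core j"
  shows "\<eta> ^ CARD('p) \<le> cell_bump (real m) j (\<lambda>_. 0) x"
proof -
  have "(\<Prod>i\<in>(UNIV::'p set). \<eta>) \<le> cell_bump (real m) j (\<lambda>_. 0) x"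
    unfolding cell_bump_def
  proof (rule prod_mono)
    fix i
    have "real m * x $ i - real (j i) \<in> {1/4..3/4}" using assms mem_core by blast
    then show "0 \<le> \<eta> \<and> \<eta> \<le> \<phi> 0 (real m * x $ i - real (j i))" using \<eta>_pos \<phi>_ge by simp
  qed
  then show ?thesis by simp
qed

lemma \<eta>_le_1: "\<eta> \<le> 1"
  using \<phi>_ge[of "1/2"] \<phi>_le[of 0 "1/2"] by auto

lemma cell_bump_measurable [measurable]: "cell_bump (real m) j (\<lambda>_. 0) \<in> borel_measurable borel"
proof -
  have "isCont (\<phi> 0) t" for t using \<phi>_deriv[of 0 t] DERIV_isCont by blast
  then have "continuous_on UNIV (\<phi> 0)" by (simp add: continuous_at_imp_continuous_on)
  then have [measurable]: "\<phi> 0 \<in> borel_measurable borel" by (rule borel_measurable_continuous_onI)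
  have [measurable]: "(\<lambda>x::real^'p. x $ i) \<in> borel_measurable borel" for i
    by (intro borel_measurable_continuous_onI continuous_intros)
  show ?thesis unfolding cell_bump_def by measurable
qed

section \<open>Tilts realising the levels\<close>

lemma level_bounds:
  assumes "finite \<omega>"
  shows "\<rho> \<le> level \<omega> x" "level \<omega> x \<le> \<rho> + \<epsilon>"
proof -
  have "0 \<le> (\<Sum>j\<in>\<omega>. cell_bump (real m) j (\<lambda>_. 0) x)" by (intro sum_nonneg cell_bump_nonneg)
  moreover have "(\<Sum>j\<in>\<omega>. cell_bump (real m) j (\<lambda>_. 0) x) \<le> 1"
    using abs_sum_cell_bump_le[OF assms, of "\<lambda>_. 0" "real m" x] by simp
  ultimately show "\<rho> \<le> level \<omega> x" "level \<omega> x \<le> \<rho> + \<epsilon>"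
    unfolding level_def using \<epsilon> by (auto intro!: mult_left_le)
qed

lemma \<rho>_\<epsilon>: "\<rho> + \<epsilon> \<le> (1 + 3 * \<rho>) / 4" "\<epsilon> \<le> \<rho> / 4" "\<epsilon> \<le> (1 - \<rho>) / 4"
proof -
  have "\<rho> * (1 - \<rho>) \<le> 1 * (1 - \<rho>)" "\<rho> * (1 - \<rho>) \<le> \<rho> * 1"
    using \<rho> by (intro mult_right_mono mult_left_mono; simp)+
  then show "\<rho> + \<epsilon> \<le> (1 + 3 * \<rho>) / 4" "\<epsilon> \<le> \<rho> / 4" "\<epsilon> \<le> (1 - \<rho>) / 4" using \<epsilon> by auto
qed

lemma level_in_unit:
  assumes "finite \<omega>"
  shows "0 < level \<omega> x" "level \<omega> x < 1"
  using level_bounds[OF assms, of x] \<rho>_\<epsilon> \<rho> by auto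

lemma abs_level_tilt_le:
  assumes "finite \<omega>"
  shows "\<bar>level_tilt \<omega> x\<bar> \<le> 2 * \<epsilon> / (\<rho> * (1 - \<rho>))"
proof -
  let ?u = "level \<omega> x"
  \<comment> \<open>Only half of the gap between \<rho> and 1 is kept, which accounts for the factor
    2 in the bound.\<close>
  have u: "\<rho> \<le> ?u" "(1 - \<rho>) / 2 \<le> 1 - ?u" "?u - \<rho> \<le> \<epsilon>"
    using level_bounds[OF assms, of x] \<rho>_\<epsilon> \<rho> by auto
  then have "\<rho> * ((1 - \<rho>) / 2) \<le> ?u * (1 - ?u)" using \<rho> by (intro mult_mono) auto
  then have "(?u - \<rho>) / (?u * (1 - ?u)) \<le> \<epsilon> / (\<rho> * ((1 - \<rho>) / 2))"
    using u \<epsilon> \<rho> by (intro frac_le) auto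
  moreover have "\<bar>level_tilt \<omega> x\<bar> = (?u - \<rho>) / (?u * (1 - ?u))"
    unfolding level_tilt_def abs_divide using u(1) level_in_unit[OF assms, of x] by (simp add: abs_mult)
  ultimately show ?thesis by (simp add: mult.commute)
qed

lemma level_measurable [measurable]: "level \<omega> \<in> borel_measurable borel"
  unfolding level_def by measurable

lemma level_tilt_measurable [measurable]: "level_tilt \<omega> \<in> borel_measurable borel"
  unfolding level_tilt_def by measurable

lemma abs_level_tilt_le_half: "finite \<omega> \<Longrightarrow> \<bar>level_tilt \<omega> x\<bar> \<le> 1 / 2"
proof -
  assume "finite \<omega>"
  from abs_level_tilt_le[OF this, of x] show ?thesis
    using \<epsilon>(2) \<rho> by (elim order_trans) (simp add: divide_le_eq)
qed

lemma tilted_model_level: "finite \<omega> \<Longrightarrow> tilted_model w (level_tilt \<omega>)"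
  using w abs_level_tilt_le_half by unfold_locales auto

lemma tilted_cdf_level:
  assumes "finite \<omega>"
  shows "tilted_cdf w (level_tilt \<omega> x) (w * level \<omega> x) = \<rho>"
  by (rule tilted_model.cond_quantile_joint(1)[OF tilted_model_level[OF assms]])
    (use level_in_unit[OF assms] in \<open>auto simp: level_tilt_def\<close>)

lemma cond_quantile_level:
  assumes "finite \<omega>"
  shows "cond_quantile (\<lambda>x. tilted w (level_tilt \<omega> x)) \<rho> = (\<lambda>x. w * level \<omega> x)"
proof
  fix x
  show "cond_quantile (\<lambda>x. tilted w (level_tilt \<omega> x)) \<rho> x = w * level \<omega> x"
    by (rule tilted_model.cond_quantile_joint(2)[OF tilted_model_level[OF assms]])
      (use level_in_unit[OF assms] in \<open>auto simp: level_tilt_def\<close>)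
qed

lemma level_insert:
  assumes "finite \<omega>" "j \<notin> \<omega>"
  shows "level (insert j \<omega>) x = level \<omega> x + \<epsilon> * cell_bump (real m) j (\<lambda>_. 0) x"
  using assms by (simp add: level_def algebra_simps)

text \<open>The tilt is a nonlinear function of the level but is zero at level \<rho>. Where bump j
  is nonzero all other bumps vanish, so the two tilts never interact and simply add.\<close>

lemma level_tilt_insert:
  assumes "finite \<omega>" "j \<notin> \<omega>"
  shows "level_tilt (insert j \<omega>) x = level_tilt \<omega> x + level_tilt {j} x"
    and "level_tilt \<omega> x = 0 \<or> level_tilt {j} x = 0"
proof -
  let ?c = "\<lambda>j. cell_bump (real m) j (\<lambda>_. 0) x"
  have "level_tilt (insert j \<omega>) x = level_tilt \<omega> x + level_tilt {j} x \<and> (level_tilt \<omega> x = 0 \<or> level_tilt {j} x = 0)"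
  proof (cases "?c j = 0")
    case True
    then show ?thesis using assms by (simp add: level_tilt_def level_def)
  next
    case False
    have "?c k = 0" if "k \<in> \<omega>" for k
      using cell_bump_disjoint[OF False, of k] that assms(2) by auto
    then have "(\<Sum>k\<in>\<omega>. ?c k) = 0" by simp
    then show ?thesis using assms by (simp add: level_tilt_def level_def)
  qed
  then show "level_tilt (insert j \<omega>) x = level_tilt \<omega> x + level_tilt {j} x"
    "level_tilt \<omega> x = 0 \<or> level_tilt {j} x = 0" by auto
qed

text \<open>The tilt of a single bump vanishes outside its cell, so its squared maximum is
  multiplied by the cell volume \<open>1 / m ^ p\<close>.\<close>

lemma level_tilt_sq_integral:
  fixes j :: "'p::finite \<Rightarrow> nat"
  shows "(\<integral>\<^sup>+x. indicator unit_cube x * ennreal ((level_tilt {j} x)\<^sup>2) \<partial>lborel)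
    \<le> ennreal ((2 * \<epsilon> / (\<rho> * (1 - \<rho>)))\<^sup>2 / real m ^ CARD('p))"
proof -
  let ?C = "cbox (\<chi> i. real (j i) / real m) (\<chi> i. (real (j i) + 1) / real m) :: (real^'p) set"
  let ?a = "2 * \<epsilon> / (\<rho> * (1 - \<rho>))"
  have "(real (j i) + 1) / real m - real (j i) / real m = 1 / real m" for i
    using m by (simp add: field_simps)
  then have vol: "emeasure lborel ?C = ennreal ((1 / real m) ^ CARD('p))"
    using m by (subst emeasure_cbox_cart) (auto intro!: divide_right_mono)
  have "(\<integral>\<^sup>+x. indicator unit_cube x * ennreal ((level_tilt {j} x)\<^sup>2) \<partial>lborel)
      \<le> (\<integral>\<^sup>+x. ennreal (?a\<^sup>2) * indicator ?C x \<partial>lborel)"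
  proof (rule nn_integral_mono)
    fix x :: "real^'p"
    show "indicator unit_cube x * ennreal ((level_tilt {j} x)\<^sup>2) \<le> ennreal (?a\<^sup>2) * indicator ?C x"
    proof (cases "cell_bump (real m) j (\<lambda>_. 0) x = 0")
      case True
      then show ?thesis by (simp add: level_tilt_def level_def)
    next
      case False
      have "x \<in> ?C"
        using cell_bump_nonzeroD[OF False] m by (auto simp: mem_box_cart field_simps intro: less_imp_le)
      moreover have "(level_tilt {j} x)\<^sup>2 \<le> ?a\<^sup>2"
        using abs_level_tilt_le[of "{j}" x] power_mono[of "\<bar>level_tilt {j} x\<bar>" ?a 2] by simp
      ultimately show ?thesis by (auto intro!: ennreal_leI split: split_indicator)
    qed
  qed
  also have "\<dots> = ennreal (?a\<^sup>2) * ennreal ((1 / real m) ^ CARD('p))"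
    unfolding vol[symmetric] by (rule nn_integral_cmult_indicator) simp
  also have "\<dots> = ennreal (?a\<^sup>2 / real m ^ CARD('p))"
    by (subst ennreal_mult[symmetric]) (auto simp: power_one_over)
  finally show ?thesis .
qed

text \<open>On the core of a cell, switching its bump moves the quantile by at least \<open>w * \<epsilon> * \<eta> ^ p\<close>,
  so a predictor misses one of the two quantiles by half of this.\<close>

definition miss :: "('p::finite \<Rightarrow> nat) set \<Rightarrow> ('p \<Rightarrow> nat) \<Rightarrow> (real^'p \<Rightarrow> real) \<Rightarrow> ennreal" where
  "miss \<omega> j f = (\<integral>\<^sup>+x. indicator (core j) x *
     indicator {x. w * \<epsilon> * \<eta> ^ CARD('p) / 2 \<le> \<bar>f x - w * level \<omega> x\<bar>} x \<partial>lborel)"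

lemma miss_flip:
  fixes f :: "real^'p::finite \<Rightarrow> real"
  assumes "finite \<omega>" "j \<notin> \<omega>" and [measurable]: "f \<in> borel_measurable borel"
  shows "ennreal ((1 / (2 * real m)) ^ CARD('p)) \<le> miss \<omega> j f + miss (insert j \<omega>) j f"
proof -
  let ?h = "w * \<epsilon> * \<eta> ^ CARD('p) / 2"
  have "ennreal ((1 / (2 * real m)) ^ CARD('p)) = (\<integral>\<^sup>+x. indicator (core j) x \<partial>lborel)"
    by (simp add: emeasure_core)
  also have "\<dots> \<le> (\<integral>\<^sup>+x. indicator (core j) x * indicator {x. ?h \<le> \<bar>f x - w * level \<omega> x\<bar>} x
      + indicator (core j) x * indicator {x. ?h \<le> \<bar>f x - w * level (insert j \<omega>) x\<bar>} x \<partial>lborel)"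
  proof (rule nn_integral_mono)
    fix x :: "real^'p"
    have "?h \<le> \<bar>f x - w * level \<omega> x\<bar> \<or> ?h \<le> \<bar>f x - w * level (insert j \<omega>) x\<bar>" if "x \<in> core j"
    proof -
      have "w * \<epsilon> * \<eta> ^ CARD('p) \<le> w * \<epsilon> * cell_bump (real m) j (\<lambda>_. 0) x"
        using cell_bump_core[OF that] w \<epsilon> by (intro mult_left_mono) auto
      also have "\<dots> = w * level (insert j \<omega>) x - w * level \<omega> x"
        by (simp add: level_insert[OF assms(1,2)] algebra_simps)
      finally show ?thesis by linarith
    qed
    then show "indicator (core j) x \<le> (indicator (core j) x * indicator {x. ?h \<le> \<bar>f x - w * level \<omega> x\<bar>} x
      + indicator (core j) x * indicator {x. ?h \<le> \<bar>f x - w * level (insert j \<omega>) x\<bar>} x :: ennreal)"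
      by (auto split: split_indicator)
  qed
  also have "\<dots> = miss \<omega> j f + miss (insert j \<omega>) j f"
    unfolding miss_def by (rule nn_integral_add) measurable
  finally show ?thesis .
qed

text \<open>Quadratic growth is used where the predictor is far from the quantile, and minimality of
  the quantile elsewhere; cores are disjoint, so the misses of all cells add up within the
  cube.\<close>

lemma excess_risk_ge_miss:
  fixes f :: "real^'p::finite \<Rightarrow> real"
  assumes bh: "0 < b" "0 < h" "\<rho> = b / (b + h)" and \<omega>: "finite \<omega>"
    and [measurable]: "f \<in> borel_measurable borel"
  shows "ennreal ((b + h) * (w * \<epsilon> * \<eta> ^ CARD('p) / 2)\<^sup>2 / (16 * w)) * (\<Sum>j\<in>cells. miss \<omega> j f)
    \<le> risk b h (joint w (level_tilt \<omega>)) f - risk b h (joint w (level_tilt \<omega>)) (\<lambda>x. w * level \<omega> x)"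
proof -
  interpret tilted_model w "level_tilt \<omega>" using \<omega> by (rule tilted_model_level)
  let ?t = "w * \<epsilon> * \<eta> ^ CARD('p) / 2" and ?q = "\<lambda>x. w * level \<omega> x"
  let ?C = "ennreal ((b + h) * ?t\<^sup>2 / (16 * w))"
  let ?E = "{x. ?t \<le> \<bar>f x - ?q x\<bar>}"
  let ?R = "\<lambda>x y. \<integral>\<^sup>+d. ennreal (loss b h d y) \<partial>tilted w (level_tilt \<omega> x)"
  have "\<epsilon> * \<eta> ^ CARD('p) \<le> \<epsilon> * 1"
    using \<epsilon> \<eta>_pos \<eta>_le_1 by (intro mult_left_mono power_le_one) auto
  then have "w * (\<epsilon> * \<eta> ^ CARD('p)) \<le> w * \<epsilon>" using w by (intro mult_left_mono) auto
  then have t: "0 < ?t" "?t \<le> w * \<epsilon>" using w \<epsilon> \<eta>_pos by (auto simp: mult.assoc)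
  have q: "?t \<le> ?q x" "?q x + ?t \<le> w" "0 \<le> ?q x" "?q x \<le> w" for x
  proof -
    have "\<epsilon> \<le> level \<omega> x" "level \<omega> x + \<epsilon> \<le> 1" "0 < w * \<epsilon>" using w \<epsilon> level_bounds[OF \<omega>, of x] \<rho>_\<epsilon> \<rho> by auto
    then have "w * \<epsilon> \<le> ?q x" "?q x + w * \<epsilon> \<le> w" "0 < w * \<epsilon>"
      using w mult_left_mono[of "level \<omega> x + \<epsilon>" 1 w] by (auto simp: distrib_left)
    with t show "?t \<le> ?q x" "?q x + ?t \<le> w" "0 \<le> ?q x" "?q x \<le> w" by linarith+
  qed
  have "(\<Sum>j\<in>cells. miss \<omega> j f) = (\<integral>\<^sup>+x. (\<Sum>j\<in>cells. indicator (core j) x * indicator ?E x) \<partial>lborel)"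
    unfolding miss_def by (rule nn_integral_sum[symmetric]) measurable
  then have "?C * (\<Sum>j\<in>cells. miss \<omega> j f)
      = (\<integral>\<^sup>+x. ?C * (\<Sum>j\<in>cells. indicator (core j) x * indicator ?E x) \<partial>lborel)"
    by (simp only:) (rule nn_integral_cmult[symmetric], measurable)
  also have "\<dots> \<le> (\<integral>\<^sup>+x. ?C * (indicator unit_cube x * indicator ?E x) \<partial>lborel)"
    by (intro nn_integral_mono mult_left_mono)
      (auto simp: sum_distrib_right[symmetric] intro!: mult_right_mono sum_indicator_core_le)
  finally have miss: "?C * (\<Sum>j\<in>cells. miss \<omega> j f) \<le> \<dots>" .
  have R_measurable [measurable]: "(\<lambda>x. ?R x (g x)) \<in> borel_measurable borel"
    if [measurable]: "g \<in> borel_measurable borel" for g :: "real^'p \<Rightarrow> real"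
    unfolding tilted_def by (subst nn_integral_density) auto
  have "risk b h (joint w (level_tilt \<omega>)) ?q + ?C * (\<Sum>j\<in>cells. miss \<omega> j f)
     \<le> (\<integral>\<^sup>+x. indicator unit_cube x * ?R x (?q x) \<partial>lborel)
      + (\<integral>\<^sup>+x. ?C * (indicator unit_cube x * indicator ?E x) \<partial>lborel)"
    using miss by (simp add: risk_joint add_left_mono)
  also have "\<dots> = (\<integral>\<^sup>+x. indicator unit_cube x * ?R x (?q x) + ?C * (indicator unit_cube x * indicator ?E x) \<partial>lborel)"
    by (rule nn_integral_add[symmetric]) measurable
  also have "\<dots> \<le> (\<integral>\<^sup>+x. indicator unit_cube x * ?R x (f x) \<partial>lborel)"
  proof (rule nn_integral_mono)
    fix x :: "real^'p"
    have cdf: "tilted_cdf w (level_tilt \<omega> x) (?q x) = b / (b + h)"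
      using tilted_cdf_level[OF \<omega>] bh(3) by simp
    have far: "?R x (?q x) + ?C \<le> ?R x (f x)" if "x \<in> ?E"
      by (rule tilted_excess_risk[OF bh(1,2) cdf t(1)]) (use that q in auto)
    have near: "?R x (?q x) \<le> ?R x (f x)"
      by (rule tilted_risk_minimal[OF bh(1,2) cdf]) (use level_in_unit[OF \<omega>, of x] w in auto)
    show "indicator unit_cube x * ?R x (?q x) + ?C * (indicator unit_cube x * indicator ?E x)
      \<le> indicator unit_cube x * ?R x (f x)"
      using far near by (cases "x \<in> ?E") (auto split: split_indicator)
  qed
  also have "\<dots> = risk b h (joint w (level_tilt \<omega>)) f" by (simp add: risk_joint)
  finally have le: "risk b h (joint w (level_tilt \<omega>)) ?q + ?C * (\<Sum>j\<in>cells. miss \<omega> j f) \<le> \<dots>" .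
  \<comment> \<open>A finite risk of the quantile lets the additive bound be rewritten with the
    truncated subtraction.\<close>
  have "risk b h (joint w (level_tilt \<omega>)) ?q
      \<le> (\<integral>\<^sup>+x. indicator (unit_cube :: (real^'p) set) x * ennreal ((b + h) * w) \<partial>lborel)"
    unfolding risk_joint[OF borel_measurable_times[OF borel_measurable_const level_measurable]]
    by (intro nn_integral_mono mult_left_mono tilted_risk_le) (use bh q in auto)
  also have "\<dots> = ennreal ((b + h) * w)"
    by (subst nn_integral_multc) (auto simp: emeasure_unit_cube)
  finally have "risk b h (joint w (level_tilt \<omega>)) ?q \<noteq> top" by (auto simp: top_unique)
  then show ?thesis using le by (simp add: ennreal_le_minus_iff add.commute)
qed

section \<open>Expectations over the sample\<close>

lemma miss_measurable:
  fixes fhat :: "(nat \<Rightarrow> (real^'p::finite) \<times> real) \<Rightarrow> real^'p \<Rightarrow> real"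
  assumes "fhat \<in> estimators n"
  shows "(\<lambda>S. miss \<omega> j (fhat S)) \<in> borel_measurable (\<Pi>\<^sub>M i\<in>{..<n}. borel)"
proof -
  let ?t = "w * \<epsilon> * \<eta> ^ CARD('p) / 2"
  have [measurable]: "(\<lambda>z. fhat (fst z) (snd z)) \<in> borel_measurable ((\<Pi>\<^sub>M i\<in>{..<n}. borel) \<Otimes>\<^sub>M borel)"
    using assms by (simp add: estimators_def case_prod_beta)
  have eq: "miss \<omega> j f = (\<integral>\<^sup>+x. indicator (core j) x * indicator {?t..} \<bar>f x - w * level \<omega> x\<bar> \<partial>lborel)" for f
    unfolding miss_def by (intro nn_integral_cong) (simp split: split_indicator)
  have "(\<lambda>(S, x). indicator (core j) x * indicator {?t..} \<bar>fhat S x - w * level \<omega> x\<bar> :: ennreal)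
      \<in> borel_measurable ((\<Pi>\<^sub>M i\<in>{..<n}. borel) \<Otimes>\<^sub>M lborel)"
    unfolding case_prod_beta by measurable
  \<comment> \<open>Joint measurability of the estimator in sample and feature makes the inner
    integral measurable in the sample.\<close>
  from lborel.borel_measurable_nn_integral[OF this] show ?thesis unfolding eq .
qed

lemma sets_sample:
  "sets (\<Pi>\<^sub>M i\<in>{..<n::nat}. joint w \<theta>) = sets (\<Pi>\<^sub>M i\<in>{..<n}. borel)"
  by (intro sets_PiM_cong) auto

lemma space_sample:
  "space (\<Pi>\<^sub>M i\<in>{..<n::nat}. joint w \<theta>) = space (\<Pi>\<^sub>M i\<in>{..<n}. borel)"
  by (intro sets_eq_imp_space_eq sets_sample)

lemma estimator_measurable:
  assumes "fhat \<in> estimators n" "S \<in> space (\<Pi>\<^sub>M i\<in>{..<n}. borel)"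
  shows "fhat S \<in> borel_measurable borel"
  using measurable_Pair2[of "\<lambda>(S, x). fhat S x", OF _ assms(2)] assms(1) by (simp add: estimators_def)

text \<open>The two-point bound with the law of \<omega> as base and the miss functionals of the two
  states as A and B. The hypothesis on n is the chi-square budget for the whole sample.\<close>

lemma expected_miss_flip:
  fixes fhat :: "(nat \<Rightarrow> (real^'p::finite) \<times> real) \<Rightarrow> real^'p \<Rightarrow> real"
  assumes fhat: "fhat \<in> estimators n" and \<omega>: "finite \<omega>" "j \<notin> \<omega>"
    and n: "real n * ((2 * \<epsilon> / (\<rho> * (1 - \<rho>)))\<^sup>2 / real m ^ CARD('p)) \<le> 1 / 4"
  shows "ennreal ((1 / (2 * real m)) ^ CARD('p)) / 4
    \<le> (\<integral>\<^sup>+S. miss \<omega> j (fhat S) \<partial>(\<Pi>\<^sub>M i\<in>{..<n}. joint w (level_tilt \<omega>)))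
      + (\<integral>\<^sup>+S. miss (insert j \<omega>) j (fhat S) \<partial>(\<Pi>\<^sub>M i\<in>{..<n}. joint w (level_tilt (insert j \<omega>))))"
proof -
  interpret tilted_model w "level_tilt \<omega>" using \<omega>(1) by (rule tilted_model_level)
  interpret I: tilted_model w "level_tilt (insert j \<omega>)" using \<omega>(1) by (intro tilted_model_level) simp
  have "joint w (\<lambda>x. level_tilt \<omega> x + level_tilt {j} x)
      = density (joint w (level_tilt \<omega>)) (\<lambda>z. ennreal (tilt_ratio w (level_tilt {j}) z))"
  proof (rule joint_tilt_density)
    show "\<bar>level_tilt {j} x\<bar> \<le> 1 / 2" for x by (rule abs_level_tilt_le_half) simp
  qed (use level_tilt_insert(2)[OF \<omega>] in auto)
  moreover have "(\<lambda>x. level_tilt \<omega> x + level_tilt {j} x) = level_tilt (insert j \<omega>)"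
    using level_tilt_insert(1)[OF \<omega>] by (intro ext) simp
  ultimately have density: "density (joint w (level_tilt \<omega>)) (\<lambda>z. ennreal (tilt_ratio w (level_tilt {j}) z))
      = joint w (level_tilt (insert j \<omega>))"
    by simp
  show ?thesis
    unfolding density[symmetric]
  proof (rule two_point_bound)
    show "prob_space (joint w (level_tilt \<omega>))" by (rule prob_space_joint)
    show "prob_space (density (joint w (level_tilt \<omega>)) (\<lambda>z. ennreal (tilt_ratio w (level_tilt {j}) z)))"
      unfolding density by (rule I.prob_space_joint)
    show "tilt_ratio w (level_tilt {j}) \<in> borel_measurable (joint w (level_tilt \<omega>))" by measurable
    show "0 \<le> tilt_ratio w (level_tilt {j}) z" for z
      using tilt_ratio_dev[OF w, of "level_tilt {j}" "fst z" "snd z"] abs_level_tilt_le_half[of "{j}" "fst z"]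
      by simp
    show "(\<integral>\<^sup>+z. ennreal ((tilt_ratio w (level_tilt {j}) z - 1)\<^sup>2) \<partial>joint w (level_tilt \<omega>))
        \<le> ennreal ((2 * \<epsilon> / (\<rho> * (1 - \<rho>)))\<^sup>2 / real m ^ CARD('p))"
      by (rule order_trans[OF chi_square_joint_le level_tilt_sq_integral]) measurable
    show "real n * ((2 * \<epsilon> / (\<rho> * (1 - \<rho>)))\<^sup>2 / real m ^ CARD('p)) \<le> 1 / 4" by (rule n)
    fix S assume "S \<in> space (\<Pi>\<^sub>M i\<in>{..<n}. joint w (level_tilt \<omega>))"
    then have "fhat S \<in> borel_measurable borel"
      using fhat by (intro estimator_measurable) (auto simp: space_sample)
    then show "ennreal ((1 / (2 * real m)) ^ CARD('p)) \<le> miss \<omega> j (fhat S) + miss (insert j \<omega>) j (fhat S)"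
      by (rule miss_flip[OF \<omega>])
  qed (use miss_measurable[OF fhat] in \<open>auto simp: measurable_cong_sets[OF sets_sample refl]\<close>)
qed

lemma expected_excess_risk_ge_miss:
  fixes fhat :: "(nat \<Rightarrow> (real^'p::finite) \<times> real) \<Rightarrow> real^'p \<Rightarrow> real"
  assumes bh: "0 < b" "0 < h" "\<rho> = b / (b + h)" and \<omega>: "finite \<omega>" and fhat: "fhat \<in> estimators n"
  shows "(\<Sum>j\<in>cells. ennreal ((b + h) * (w * \<epsilon> * \<eta> ^ CARD('p) / 2)\<^sup>2 / (16 * w)) *
      (\<integral>\<^sup>+S. miss \<omega> j (fhat S) \<partial>(\<Pi>\<^sub>M i\<in>{..<n}. joint w (level_tilt \<omega>))))
    \<le> expected_excess_risk b h n (joint w (level_tilt \<omega>)) (\<lambda>x. w * level \<omega> x) fhat"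
proof -
  let ?C = "ennreal ((b + h) * (w * \<epsilon> * \<eta> ^ CARD('p) / 2)\<^sup>2 / (16 * w))"
  let ?P = "\<Pi>\<^sub>M i\<in>{..<n}. joint w (level_tilt \<omega>)"
  have [measurable]: "(\<lambda>S. miss \<omega> j (fhat S)) \<in> borel_measurable ?P" for j
    using miss_measurable[OF fhat] by (simp add: measurable_cong_sets[OF sets_sample refl])
  have "(\<Sum>j\<in>cells. ?C * (\<integral>\<^sup>+S. miss \<omega> j (fhat S) \<partial>?P)) = ?C * (\<integral>\<^sup>+S. (\<Sum>j\<in>cells. miss \<omega> j (fhat S)) \<partial>?P)"
    by (simp add: nn_integral_sum sum_distrib_left)
  also have "\<dots> = (\<integral>\<^sup>+S. ?C * (\<Sum>j\<in>cells. miss \<omega> j (fhat S)) \<partial>?P)"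
    by (rule nn_integral_cmult[symmetric]) measurable
  also have "\<dots> \<le> expected_excess_risk b h n (joint w (level_tilt \<omega>)) (\<lambda>x. w * level \<omega> x) fhat"
    unfolding expected_excess_risk_def
    by (intro nn_integral_mono excess_risk_ge_miss[OF bh \<omega>] estimator_measurable[OF fhat])
      (simp add: space_sample)
  finally show ?thesis .
qed

text \<open>The \<open>m ^ p\<close> cores of volume \<open>(1 / (2 * m)) ^ p\<close> have total
  volume \<open>(1/2) ^ p\<close>, so m enters only through \<epsilon>. The factor 1/8 is 1/4 from
  testing times 1/2 from averaging over the hypercube.\<close>

lemma minimax_lower_bound:
  fixes fhat :: "(nat \<Rightarrow> (real^'p::finite) \<times> real) \<Rightarrow> real^'p \<Rightarrow> real"
  assumes bh: "0 < b" "0 < h" "\<rho> = b / (b + h)" and fhat: "fhat \<in> estimators n"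
    and n: "real n * ((2 * \<epsilon> / (\<rho> * (1 - \<rho>)))\<^sup>2 / real m ^ CARD('p)) \<le> 1 / 4"
    and M: "\<And>\<omega>. \<omega> \<subseteq> cells \<Longrightarrow>
      expected_excess_risk b h n (joint w (level_tilt \<omega>)) (\<lambda>x. w * level \<omega> x) fhat \<le> M"
  shows "ennreal ((b + h) * (w * \<epsilon> * \<eta> ^ CARD('p) / 2)\<^sup>2 / (16 * w) * (1/2) ^ CARD('p) / 8) \<le> M"
proof -
  define C where "C = (b + h) * (w * \<epsilon> * \<eta> ^ CARD('p) / 2)\<^sup>2 / (16 * w)"
  define v where "v = (1 / (2 * real m)) ^ CARD('p)"
  have C: "0 \<le> C" using bh w by (simp add: C_def)
  have v: "0 \<le> v" by (simp add: v_def)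
  let ?e = "\<lambda>\<omega> j. ennreal C * (\<integral>\<^sup>+S. miss \<omega> j (fhat S) \<partial>(\<Pi>\<^sub>M i\<in>{..<n}. joint w (level_tilt \<omega>)))"
  have "of_nat (card (cells :: ('p \<Rightarrow> nat) set)) * (ennreal C * (ennreal v / 4)) \<le> 2 * M"
  proof (rule assouad_sum[OF finite_cells])
    fix j :: "'p \<Rightarrow> nat" and \<omega> assume \<omega>: "\<omega> \<subseteq> cells - {j}"
    then have "finite \<omega>" by (rule finite_subset) simp
    with \<omega> have "ennreal v / 4 \<le> (\<integral>\<^sup>+S. miss \<omega> j (fhat S) \<partial>(\<Pi>\<^sub>M i\<in>{..<n}. joint w (level_tilt \<omega>)))
      + (\<integral>\<^sup>+S. miss (insert j \<omega>) j (fhat S) \<partial>(\<Pi>\<^sub>M i\<in>{..<n}. joint w (level_tilt (insert j \<omega>))))"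
      unfolding v_def by (intro expected_miss_flip[OF fhat _ _ n]) auto
    from mult_left_mono[OF this, of "ennreal C"]
    show "ennreal C * (ennreal v / 4) \<le> ?e \<omega> j + ?e (insert j \<omega>) j" by (simp add: distrib_left)
  next
    fix \<omega> :: "('p \<Rightarrow> nat) set" assume \<omega>: "\<omega> \<subseteq> cells"
    then have "finite \<omega>" by (rule finite_subset) simp
    from expected_excess_risk_ge_miss[OF bh this fhat] M[OF \<omega>]
    show "(\<Sum>j\<in>cells. ?e \<omega> j) \<le> M" unfolding C_def by (rule order_trans)
  qed
  also have "of_nat (card (cells :: ('p \<Rightarrow> nat) set)) * (ennreal C * (ennreal v / 4))
      = ennreal (real (m ^ CARD('p))) * (ennreal C * ennreal (v / 4))"
    unfolding card_cells ennreal_of_nat_eq_real_of_nat using v by (simp add: ennreal_divide_numeral)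
  also have "\<dots> = ennreal (real (m ^ CARD('p)) * (C * (v / 4)))"
  proof -
    have "ennreal C * ennreal (v / 4) = ennreal (C * (v / 4))"
      by (rule ennreal_mult[symmetric]) (use C v in auto)
    then show ?thesis
      by (simp only:) (rule ennreal_mult[symmetric]; use C v in simp)
  qed
  also have "real (m ^ CARD('p)) * (C * (v / 4)) = 2 * (C * (1/2) ^ CARD('p) / 8)"
  proof -
    have "real (m ^ CARD('p)) * v = (1/2) ^ CARD('p)"
      unfolding v_def of_nat_power power_mult_distrib[symmetric] using m by simp
    then show ?thesis by (simp add: mult_ac)
  qed
  also have "ennreal (2 * (C * (1/2) ^ CARD('p) / 8)) = 2 * ennreal (C * (1/2) ^ CARD('p) / 8)"
    using C by (subst ennreal_mult) auto
  finally have "2 * ennreal (C * (1/2) ^ CARD('p) / 8) \<le> 2 * M" .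
  then show ?thesis
    unfolding C_def[symmetric] by (subst (asm) ennreal_mult_le_mult_iff) auto
qed

end

section \<open>The minimax rate\<close>

theorem theorem4:
  fixes b h \<rho> \<beta> B\<^sub>0 Dbar \<kappa> :: real
  assumes "b > 0" and "h > 0" and "\<rho> = b / (b + h)"
    and "\<beta> > 0" and "B\<^sub>0 > 0" and "Dbar > 0" and "\<kappa> > 0"
  shows "\<exists>c>0. \<forall>n\<ge>1.
    (INF fhat \<in> (estimators n :: ((nat \<Rightarrow> (real^'p::finite) \<times> real) \<Rightarrow> real^'p \<Rightarrow> real) set).
       SUP (P, K) \<in> newsvendor_class \<rho> \<beta> B\<^sub>0 Dbar \<kappa>.
         expected_excess_risk b h n P (cond_quantile K \<rho>) fhat)
    \<ge> ennreal (c * real n powr (- (2 * \<beta>) / (real CARD('p) + 2 * \<beta>)))"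
proof -
  let ?p = "CARD('p)"
  have \<rho>: "0 < \<rho>" "\<rho> < 1" using assms(1,2) by (auto simp: assms(3))
  obtain \<phi> \<eta> where "bump \<phi> \<eta> (smoothness_order \<beta>)"
  proof (rule smooth_bump_1d[of "smoothness_order \<beta>"], goal_cases)
    case (1 \<phi> \<eta>)
    then have "bump \<phi> \<eta> (smoothness_order \<beta>)" unfolding bump_def by blast
    then show ?case by (rule that)
  qed
  then interpret bump \<phi> \<eta> "smoothness_order \<beta>" .
  \<comment> \<open>The three entries give demand within \<open>Dbar\<close>, density at least
    \<kappa>, and at most half of the Hoelder budget for the constant
    \<open>w * \<rho>\<close>.\<close>
  define w where "w = min Dbar (min (1 / (2 * \<kappa>)) (B\<^sub>0 / 2))"
  have w0: "0 < w" "w \<le> Dbar" "w \<le> 1 / (2 * \<kappa>)" "w \<le> B\<^sub>0 / 2" using assms by (auto simp: w_def)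
  have \<kappa>: "\<kappa> \<le> 1 / (2 * w)" using w0 assms(7) by (simp add: field_simps)
  \<comment> \<open>The first entry is the admissibility bound of the hypercube; the second leaves
    the other half of the Hoelder budget to the bumps.\<close>
  define a where "a = min (\<rho> * (1 - \<rho>) / 4) (B\<^sub>0 / (8 * real ?p * w))"
  have a: "0 < a" "a \<le> \<rho> * (1 - \<rho>) / 4" "a \<le> B\<^sub>0 / (8 * real ?p * w)"
    using \<rho> w0 assms(5) by (auto simp: a_def)
  define c where "c = (b + h) * (w * a * \<eta> ^ ?p / 2)\<^sup>2 / (16 * w) * (1/2) ^ ?p / 8 * 2 powr (- (2 * \<beta>))"
  have "0 < c" using assms w0 a \<eta>_pos by (simp add: c_def)
  moreover have "ennreal (c * real n powr (- (2 * \<beta>) / (real ?p + 2 * \<beta>)))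
    \<le> (INF fhat \<in> (estimators n :: ((nat \<Rightarrow> (real^'p) \<times> real) \<Rightarrow> real^'p \<Rightarrow> real) set).
       SUP (P, K) \<in> newsvendor_class \<rho> \<beta> B\<^sub>0 Dbar \<kappa>. expected_excess_risk b h n P (cond_quantile K \<rho>) fhat)"
    if n: "1 \<le> n" for n
  proof (rule INF_greatest)
    fix fhat :: "(nat \<Rightarrow> (real^'p) \<times> real) \<Rightarrow> real^'p \<Rightarrow> real"
    assume fhat: "fhat \<in> estimators n"
    define r where "r = real n powr (1 / (real ?p + 2 * \<beta>))"
    \<comment> \<open>Rounding up gives \<open>n \<le> m powr (p + 2 * \<beta>)\<close>, as the
      chi-square budget requires. Since n is at least one, so is r, and m is at most 2 r; this costs
      the factor \<open>2 powr (- (2 * \<beta>))\<close> in c.\<close>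
    define m where "m = nat \<lceil>r\<rceil>"
    have r: "1 \<le> r" unfolding r_def using n assms(4) by (intro ge_one_powr_ge_zero) auto
    have mr: "1 \<le> m" "r \<le> real m" "real m \<le> 2 * r" using r unfolding m_def by linarith+
    define \<epsilon> where "\<epsilon> = a * real m powr (- \<beta>)"
    have "real m powr (- \<beta>) \<le> real m powr 0" using mr assms(4) by (intro powr_mono) auto
    then have "\<epsilon> \<le> a" unfolding \<epsilon>_def using a(1) mr by (intro mult_left_le) auto
    then have \<epsilon>: "0 < \<epsilon>" "\<epsilon> \<le> \<rho> * (1 - \<rho>) / 4"
      using a mr unfolding \<epsilon>_def by (simp, linarith)
    interpret hypercube \<phi> \<eta> "smoothness_order \<beta>" w \<rho> \<epsilon> m
      by unfold_locales (use w0 \<rho> \<epsilon> mr in auto)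
    have \<epsilon>2: "\<epsilon>\<^sup>2 = a\<^sup>2 * real m powr (- (2 * \<beta>))"
      unfolding \<epsilon>_def power_mult_distrib using mr powr_add[of "real m" "- \<beta>" "- \<beta>"] by (simp add: power2_eq_square)
    \<comment> \<open>The choice of m bounds \<open>n * m powr (- (2 * \<beta>)) / m ^ p\<close> by
      one, and the bound on a makes the remaining factor at most the square of 1/2.\<close>
    have sample: "real n * ((2 * \<epsilon> / (\<rho> * (1 - \<rho>)))\<^sup>2 / real m ^ ?p) \<le> 1 / 4"
    proof -
      have "real n = r powr (real ?p + 2 * \<beta>)"
        unfolding r_def powr_powr using assms(4) n by simp
      also have "\<dots> \<le> real m powr (real ?p + 2 * \<beta>)" using mr r assms(4) by (intro powr_mono2) auto
      finally have nm: "real n \<le> real m powr (real ?p + 2 * \<beta>)" .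
      have "2 * a / (\<rho> * (1 - \<rho>)) \<le> 1 / 2" using a(2) \<rho> by (simp add: divide_le_eq)
      then have q: "(2 * a / (\<rho> * (1 - \<rho>)))\<^sup>2 \<le> (1 / 2)\<^sup>2" using a \<rho> by (intro power_mono) auto
      have "real m powr (real ?p + 2 * \<beta>) * real m powr (- (2 * \<beta>)) = real m ^ ?p"
        using mr by (simp add: powr_realpow flip: powr_add)
      then have "real n * real m powr (- (2 * \<beta>)) \<le> real m ^ ?p"
        using mult_right_mono[OF nm, of "real m powr (- (2 * \<beta>))"] by simp
      then have "real n * real m powr (- (2 * \<beta>)) / real m ^ ?p \<le> 1" using mr by (simp add: divide_le_eq)
      then have "(2 * a / (\<rho> * (1 - \<rho>)))\<^sup>2 * (real n * real m powr (- (2 * \<beta>)) / real m ^ ?p) \<le> (1 / 2)\<^sup>2 * 1"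
        using q by (intro mult_mono) auto
      also have "(2 * a / (\<rho> * (1 - \<rho>)))\<^sup>2 * (real n * real m powr (- (2 * \<beta>)) / real m ^ ?p)
          = real n * ((2 * \<epsilon> / (\<rho> * (1 - \<rho>)))\<^sup>2 / real m ^ ?p)"
        by (simp add: power_divide power_mult_distrib \<epsilon>2)
      finally show ?thesis by (simp add: power2_eq_square)
    qed
    let ?M = "SUP (P, K) \<in> newsvendor_class \<rho> \<beta> B\<^sub>0 Dbar \<kappa>. expected_excess_risk b h n P (cond_quantile K \<rho>) fhat"
    have upper: "expected_excess_risk b h n (joint w (level_tilt \<omega>)) (\<lambda>x. w * level \<omega> x) fhat \<le> ?M"
      if "\<omega> \<subseteq> cells" for \<omega> :: "('p \<Rightarrow> nat) set"
    proof -
      have fin: "finite \<omega>" using that by (rule finite_subset) simp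
      interpret tilted_model w "level_tilt \<omega>" using fin by (rule tilted_model_level)
      have "0 \<le> w * \<rho>" "w * \<rho> \<le> w" using w0 \<rho> by (auto intro: mult_left_le)
      moreover have "4 * real ?p * (w * a) \<le> B\<^sub>0 / 2"
        using a(3) w0 by (simp add: field_simps)
      ultimately have B: "\<bar>w * \<rho>\<bar> + 4 * real ?p * (w * a) \<le> B\<^sub>0" using w0 by linarith
      have "(\<lambda>x. w * \<rho> + w * a * real m powr (- \<beta>) * (\<Sum>j\<in>\<omega>. cell_bump (real m) j (\<lambda>_. 0) x))
          \<in> holder_class \<beta> unit_cube B\<^sub>0"
        by (rule bump_sum_in_holder_class[OF assms(4) refl fin _ _ B]) (use mr w0 a in auto)
      also have "(\<lambda>x. w * \<rho> + w * a * real m powr (- \<beta>) * (\<Sum>j\<in>\<omega>. cell_bump (real m) j (\<lambda>_. 0) x))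
          = (\<lambda>x. w * level \<omega> x)"
        unfolding level_def by (simp add: \<epsilon>_def distrib_left mult.assoc)
      also have "\<dots> = cond_quantile (\<lambda>x. tilted w (level_tilt \<omega> x)) \<rho>"
        using cond_quantile_level[OF fin] by simp
      finally have "(joint w (level_tilt \<omega>), \<lambda>x. tilted w (level_tilt \<omega> x)) \<in> newsvendor_class \<rho> \<beta> B\<^sub>0 Dbar \<kappa>"
        by (rule joint_in_newsvendor_class[OF w0(2) \<kappa>])
      then show ?thesis
        by (rule SUP_upper2) (simp add: cond_quantile_level[OF fin])
    qed
    have "2 powr (- (2 * \<beta>)) * real n powr (- (2 * \<beta>) / (real ?p + 2 * \<beta>)) = (2 * r) powr (- (2 * \<beta>))"
      unfolding r_def by (simp add: powr_mult powr_powr)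
    \<comment> \<open>The exponent is negative, so the upper bound on m is the relevant one.\<close>
    also have "\<dots> \<le> real m powr (- (2 * \<beta>))" using mr r assms(4) by (intro powr_mono2') auto
    finally have rate: "2 powr (- (2 * \<beta>)) * real n powr (- (2 * \<beta>) / (real ?p + 2 * \<beta>)) \<le> real m powr (- (2 * \<beta>))" .
    have "c * real n powr (- (2 * \<beta>) / (real ?p + 2 * \<beta>))
        = (b + h) * (w * a * \<eta> ^ ?p / 2)\<^sup>2 / (16 * w) * (1/2) ^ ?p / 8
          * (2 powr (- (2 * \<beta>)) * real n powr (- (2 * \<beta>) / (real ?p + 2 * \<beta>)))"
      by (simp add: c_def)
    also have "\<dots> \<le> (b + h) * (w * a * \<eta> ^ ?p / 2)\<^sup>2 / (16 * w) * (1/2) ^ ?p / 8 * real m powr (- (2 * \<beta>))"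
      using rate assms w0 by (intro mult_left_mono) auto
    also have "\<dots> = (b + h) * (w * \<epsilon> * \<eta> ^ ?p / 2)\<^sup>2 / (16 * w) * (1/2) ^ ?p / 8"
      by (simp add: power_divide power_mult_distrib \<epsilon>2)
    finally have "ennreal (c * real n powr (- (2 * \<beta>) / (real ?p + 2 * \<beta>)))
        \<le> ennreal ((b + h) * (w * \<epsilon> * \<eta> ^ ?p / 2)\<^sup>2 / (16 * w) * (1/2) ^ ?p / 8)"
      by (rule ennreal_leI)
    also have "\<dots> \<le> ?M" by (rule minimax_lower_bound[OF assms(1-3) fhat sample upper])
    finally show "ennreal (c * real n powr (- (2 * \<beta>) / (real ?p + 2 * \<beta>))) \<le> ?M" .
  qed
  ultimately show ?thesis by blast
qed

end
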